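(* Let $\mathcal F$ be a class of Borel measurable real functions on a topological space $S$ with a finite envelope $F$. For a given $\mu\in\mathcal P(S)$, let $\delta$ be a map from $\mathcal P_0\subset\mathcal P(S)$ into a Banach space $(\mathfrak E,\|\cdot\|_{\mathfrak E})$, where $\mathcal P_0$ is a convex subset such that $\mu\in\mathcal P_0$ and $\int F\,d\nu<\infty$ for all $\nu\in\mathcal P_0$. Suppose that (a) $\mu_n:\Omega\to\mathcal P_0$, $n\in\mathbb N$, are random probability measures with values in $\mathcal P_0$ such that there exists a tight random variable $G_\mu$ in $\ell^\infty(\mathcal F)$ with $\sqrt n(\mu_n-\mu)\stackrel{d}{\to}G_\mu$ in $\ell^\infty(\mathcal F)$; (b) $\delta$ is locally Lipschitz continuous at $\mu$ with respect to $\|\cdot\|_{\infty,\mathcal F}$, in the sense that there exist constants $\epsilon>0$ and $C<\infty$ such that, for $\nu,\nu'\in\mathcal P_0$, $$\|\nu-\mu\|_{\infty,\mathcal F}\vee\|\nu'-\mu\|_{\infty,\mathcal F}<\epsilon\ \Longrightarrow\ \|\delta(\nu)-\delta(\nu')\|_{\mathfrak E}\le C\|\nu-\nu'\|_{\infty,\mathcal F};$$ (c) for every $\nu\in\mathcal P_0$, the mapping $t\mapsto\delta(\mu+t(\nu-\mu))$ is right differentiable at $t=0$, with right derivative denoted by $$\delta'_\mu(\nu-\mu)=\lim_{t\downarrow0}\frac{\delta(\mu+t(\nu-\mu))-\delta(\mu)}{t}.$$ Then: (i) $\delta'_\mu$ uniquely extends to a continuous, positively homogeneous map on the tangent cone of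 $\mathcal P_0$ at $\mu$, $$\mathcal T_{\mathcal P_0}(\mu):=\overline{\{t(\nu-\mu):\nu\in\mathcal P_0,\ t>0\}}^{\,\ell^\infty(\mathcal F)};$$ (ii) $G_\mu\in\mathcal T_{\mathcal P_0}(\mu)$ almost surely; (iii) $\sqrt n(\delta(\mu_n)-\delta(\mu))-\delta'_\mu(\sqrt n(\mu_n-\mu))\to0$ in outer probability. Consequently, $\sqrt n(\delta(\mu_n)-\delta(\mu))\stackrel{d}{\to}\delta'_\mu(G_\mu)$.
   Context: $\mathcal P(S)$ is the set of Borel probability measures on $S$. An envelope of $\mathcal F$ is a measurable function $F\ge0$ with $|f|\le F$ for all $f\in\mathcal F$. $\ell^\infty(\mathcal F)$ is the Banach space of bounded real functions on $\mathcal F$ with sup-norm $\|z\|_{\infty,\mathcal F}=\sup_{f\in\mathcal F}|z(f)|$. A finite signed measure $\gamma$ integrating $F$ is identified with the functional $f\mapsto\gamma(f)=\int f\,d\gamma$ in $\ell^\infty(\mathcal F)$; thus $\nu-\mu$ for $\nu\in\mathcal P_0$ is viewed as an element of $\ell^\infty(\mathcal F)$, and closures, norms and convergence are in $\ell^\infty(\mathcal F)$. $(\Omega,\mathcal A,\mathbb P)$ is the underlying probability space. Convergence in distribution $\stackrel{d}{\to}$ is in the sense of Hoffmann-Jørgensen when necessary. $a\vee b=\max\{a,b\}$. *)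

theory Defs
  imports "HOL-Probability.Probability"
begin

section \<open>Mixtures of probability measures\<close>

text \<open>For \<open>0 \<le> t \<le> 1\<close> this is the measure \<open>\<mu> + t (\<nu> - \<mu>)\<close>; it is only meaningful for such
  \<open>t\<close> and for \<open>\<mu>\<close>, \<open>\<nu>\<close> on the same sigma-algebra.\<close>

definition mixture :: "real \<Rightarrow> 'a measure \<Rightarrow> 'a measure \<Rightarrow> 'a measure" where
  "mixture t \<mu> \<nu> = measure_of (space \<mu>) (sets \<mu>)
     (\<lambda>A. ennreal (1 - t) * emeasure \<mu> A + ennreal t * emeasure \<nu> A)"

lemma space_mixture [simp]: "space (mixture t \<mu> \<nu>) = space \<mu>"
  by (simp add: mixture_def space_measure_of_conv)

lemma sets_mixture [simp]: "sets (mixture t \<mu> \<nu>) = sets \<mu>"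
  by (simp add: mixture_def)

lemma emeasure_mixture:
  assumes "sets \<nu> = sets \<mu>" and A: "A \<in> sets \<mu>"
  shows "emeasure (mixture t \<mu> \<nu>) A = ennreal (1 - t) * emeasure \<mu> A + ennreal t * emeasure \<nu> A"
  unfolding mixture_def
proof (rule emeasure_measure_of_sigma)
  show "sigma_algebra (space \<mu>) (sets \<mu>)"
    by (rule sets.sigma_algebra_axioms)
  show "positive (sets \<mu>) (\<lambda>A. ennreal (1 - t) * emeasure \<mu> A + ennreal t * emeasure \<nu> A)"
    by (simp add: positive_def)
  show "countably_additive (sets \<mu>)
      (\<lambda>A. ennreal (1 - t) * emeasure \<mu> A + ennreal t * emeasure \<nu> A)"
  proof (rule countably_additiveI)
    fix B :: "nat \<Rightarrow> 'a set"
    assume B: "range B \<subseteq> sets \<mu>" "disjoint_family B"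
    then have "range B \<subseteq> sets \<nu>"
      using assms by simp
    with B show "(\<Sum>i. ennreal (1 - t) * emeasure \<mu> (B i) + ennreal t * emeasure \<nu> (B i))
        = ennreal (1 - t) * emeasure \<mu> (\<Union> (range B)) + ennreal t * emeasure \<nu> (\<Union> (range B))"
      by (simp add: suminf_add [symmetric] suminf_emeasure)
  qed
qed (rule A)

lemma prob_space_mixture:
  assumes "prob_space \<mu>" "prob_space \<nu>" "sets \<nu> = sets \<mu>" "0 \<le> t" "t \<le> 1"
  shows "prob_space (mixture t \<mu> \<nu>)"
proof
  have "space \<nu> = space \<mu>"
    using assms(3) by (rule sets_eq_imp_space_eq)
  then have "emeasure (mixture t \<mu> \<nu>) (space \<mu>) = ennreal (1 - t) + ennreal t"
    using assms prob_space.emeasure_space_1 [of \<mu>] prob_space.emeasure_space_1 [of \<nu>]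
    by (simp add: emeasure_mixture)
  also have "\<dots> = 1"
    using assms by (simp flip: ennreal_plus)
  finally show "emeasure (mixture t \<mu> \<nu>) (space (mixture t \<mu> \<nu>)) = 1"
    by simp
qed

definition convex_measures :: "'a measure set \<Rightarrow> bool" where
  "convex_measures P0 \<longleftrightarrow> (\<forall>\<mu>\<in>P0. \<forall>\<nu>\<in>P0. \<forall>t\<in>{0..1}. mixture t \<mu> \<nu> \<in> P0)"


section \<open>The space of bounded functions on a class, with the sup-norm\<close>

text \<open>Elements are bounded real functions on \<open>\<F>\<close>, made extensional (\<open>undefined\<close> off \<open>\<F>\<close>) so that
  equality of elements is equality on \<open>\<F>\<close>.\<close>

definition linf :: "'i set \<Rightarrow> ('i \<Rightarrow> real) metric" where
  "linf \<F> = funspace \<F> euclidean_metric"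

text \<open>Inserting \<open>0\<close> does not affect the supremum unless \<open>\<F>\<close> is empty.\<close>

definition linf_norm :: "'i set \<Rightarrow> ('i \<Rightarrow> real) \<Rightarrow> real" where
  "linf_norm \<F> z = Sup (insert 0 ((\<lambda>f. \<bar>z f\<bar>) ` \<F>))"

definition linf_scale :: "'i set \<Rightarrow> real \<Rightarrow> ('i \<Rightarrow> real) \<Rightarrow> 'i \<Rightarrow> real" where
  "linf_scale \<F> t z = (\<lambda>f\<in>\<F>. t * z f)"

text \<open>The functional \<open>f \<mapsto> (\<nu> - \<mu>)(f)\<close>, i.e. the finite signed measure \<open>\<nu> - \<mu>\<close> seen as an
  element of \<^term>\<open>linf \<F>\<close>.\<close>

definition meas_diff ::
  "('a \<Rightarrow> real) set \<Rightarrow> 'a measure \<Rightarrow> 'a measure \<Rightarrow> ('a \<Rightarrow> real) \<Rightarrow> real" where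
  "meas_diff \<F> \<nu> \<mu> = (\<lambda>f\<in>\<F>. (\<integral>x. f x \<partial>\<nu>) - (\<integral>x. f x \<partial>\<mu>))"

lemma mspace_linf: "mspace (linf \<F>) = {z \<in> extensional \<F>. bounded (z ` \<F>)}"
  unfolding linf_def funspace_def mspace_euclidean_metric mdist_euclidean_metric
  by (subst Metric_space.mspace_metric [OF Met_TC.Metric_space_funspace])
     (auto simp: Met_TC.fspace_def)

lemma linf_norm_eq_SUP:
  assumes "\<F> \<noteq> {}" "z \<in> mspace (linf \<F>)"
  shows "linf_norm \<F> z = (SUP f\<in>\<F>. \<bar>z f\<bar>)"
proof -
  have bdd: "bdd_above ((\<lambda>f. \<bar>z f\<bar>) ` \<F>)"
    using assms(2) by (auto simp: mspace_linf bounded_iff bdd_above_def)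
  obtain f where "f \<in> \<F>"
    using assms(1) by blast
  then have "0 \<le> (SUP f\<in>\<F>. \<bar>z f\<bar>)"
    using bdd by (meson abs_ge_zero cSUP_upper2)
  then show ?thesis
    using assms(1) bdd by (simp add: linf_norm_def cSup_insert sup_max)
qed

lemma mdist_linf:
  assumes "z \<in> mspace (linf \<F>)" "w \<in> mspace (linf \<F>)"
  shows "mdist (linf \<F>) z w = linf_norm \<F> (\<lambda>f\<in>\<F>. z f - w f)"
proof -
  have mem: "z \<in> Met_TC.fspace \<F>" "w \<in> Met_TC.fspace \<F>"
    using assms by (auto simp: mspace_linf Met_TC.fspace_def)
  have dist: "mdist (linf \<F>) z w = (if \<F> = {} then 0 else SUP f\<in>\<F>. \<bar>z f - w f\<bar>)"
    unfolding linf_def funspace_def mspace_euclidean_metric mdist_euclidean_metric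
    by (subst Metric_space.mdist_metric [OF Met_TC.Metric_space_funspace])
       (use mem in \<open>auto simp: Met_TC.fdist_def dist_real_def\<close>)
  show ?thesis
  proof (cases "\<F> = {}")
    case True
    with dist show ?thesis
      by (simp add: linf_norm_def)
  next
    case False
    have "bounded ((\<lambda>f. z f - w f) ` \<F>)"
      using assms by (auto simp: mspace_linf intro: bounded_minus_comp)
    then have "(\<lambda>f\<in>\<F>. z f - w f) \<in> mspace (linf \<F>)"
      by (simp add: mspace_linf)
    from linf_norm_eq_SUP [OF False this] False dist show ?thesis
      by simp
  qed
qed

lemma meas_diff_in_linf:
  assumes "\<F> \<subseteq> borel_measurable borel" "\<And>f x. f \<in> \<F> \<Longrightarrow> \<bar>f x\<bar> \<le> F x"
    and "sets \<nu> = sets borel" "sets \<mu> = sets borel" "integrable \<nu> F" "integrable \<mu> F"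
  shows "meas_diff \<F> \<nu> \<mu> \<in> mspace (linf \<F>)"
proof -
  have *: "\<bar>\<integral>x. f x \<partial>\<rho>\<bar> \<le> (\<integral>x. F x \<partial>\<rho>)"
    if f: "f \<in> \<F>" and \<rho>: "sets \<rho> = sets borel" "integrable \<rho> F" for f \<rho>
  proof -
    have "f \<in> borel_measurable \<rho>"
      using assms(1) f measurable_cong_sets [OF \<rho>(1) refl] by blast
    moreover have "AE x in \<rho>. norm (f x) \<le> norm (F x)"
      using assms(2) [OF f] by (intro AE_I2) (metis abs_ge_self order_trans real_norm_def)
    ultimately have "integrable \<rho> f"
      by (rule Bochner_Integration.integrable_bound [OF \<rho>(2)])
    then have "(\<integral>x. \<bar>f x\<bar> \<partial>\<rho>) \<le> (\<integral>x. F x \<partial>\<rho>)"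
      by (intro integral_mono integrable_abs \<rho>(2) assms(2) f)
    with integral_abs_bound [of \<rho> f] show ?thesis
      by (rule order_trans)
  qed
  have "\<bar>(\<integral>x. f x \<partial>\<nu>) - (\<integral>x. f x \<partial>\<mu>)\<bar> \<le> (\<integral>x. F x \<partial>\<nu>) + (\<integral>x. F x \<partial>\<mu>)" if "f \<in> \<F>" for f
    using *[OF that assms(3,5)] *[OF that assms(4,6)] by linarith
  then show ?thesis
    by (auto simp: mspace_linf meas_diff_def bounded_iff)
qed


section \<open>Convergence in distribution in the sense of Hoffmann-Joergensen\<close>

definition borel_of_topology :: "'a topology \<Rightarrow> 'a measure" where
  "borel_of_topology X = sigma (topspace X) {U. openin X U}"

text \<open>The outer expectation \<open>E\<^sup>* T\<close>. It is used for bounded \<open>T\<close> on a probability space only; there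
  extended-real-valued majorants or majorants with infinite expectation would not change the
  infimum.\<close>

definition outer_expectation :: "'w measure \<Rightarrow> ('w \<Rightarrow> real) \<Rightarrow> real" where
  "outer_expectation M T =
     Inf {integral\<^sup>L M u | u. integrable M u \<and> (\<forall>\<omega>\<in>space M. T \<omega> \<le> u \<omega>)}"

text \<open>The maps \<open>X n\<close> need not be measurable; the limit \<open>Y\<close> is Borel measurable and may live on
  another probability space.\<close>

definition HJ_conv_in_dist ::
  "'w measure \<Rightarrow> 'a topology \<Rightarrow> (nat \<Rightarrow> 'w \<Rightarrow> 'a) \<Rightarrow> 'v measure \<Rightarrow> ('v \<Rightarrow> 'a) \<Rightarrow> bool" where
  "HJ_conv_in_dist M T X N Y \<longleftrightarrow>
     (\<forall>n. X n \<in> space M \<rightarrow> topspace T) \<and>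
     Y \<in> measurable N (borel_of_topology T) \<and>
     (\<forall>h :: 'a \<Rightarrow> real. continuous_map T euclideanreal h \<and> bounded (h ` topspace T) \<longrightarrow>
        (\<lambda>n. outer_expectation M (\<lambda>\<omega>. h (X n \<omega>))) \<longlonglongrightarrow> (\<integral>\<omega>. h (Y \<omega>) \<partial>N))"

definition tight_rv :: "'v measure \<Rightarrow> 'a topology \<Rightarrow> ('v \<Rightarrow> 'a) \<Rightarrow> bool" where
  "tight_rv N T Y \<longleftrightarrow> Y \<in> measurable N (borel_of_topology T) \<and>
     (\<forall>e>0. \<exists>K. compactin T K \<and> K \<in> sets (borel_of_topology T) \<and>
        measure N {\<omega> \<in> space N. Y \<omega> \<in> K} \<ge> 1 - e)"

definition conv_outer_prob_0 ::
  "'w measure \<Rightarrow> (nat \<Rightarrow> 'w \<Rightarrow> 'e::real_normed_vector) \<Rightarrow> bool" where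
  "conv_outer_prob_0 M Z \<longleftrightarrow>
     (\<forall>e>0. (\<lambda>n. outer_measure_of M {\<omega> \<in> space M. norm (Z n \<omega>) > e}) \<longlonglongrightarrow> 0)"


section \<open>Tangent cone and extension of the derivative\<close>

definition tangent_cone ::
  "('a \<Rightarrow> real) set \<Rightarrow> 'a measure set \<Rightarrow> 'a measure \<Rightarrow> (('a \<Rightarrow> real) \<Rightarrow> real) set" where
  "tangent_cone \<F> P0 \<mu> = (mtopology_of (linf \<F>)) closure_of
     {linf_scale \<F> t (meas_diff \<F> \<nu> \<mu>) | t \<nu>. t > 0 \<and> \<nu> \<in> P0}"

text \<open>\<open>\<delta>' \<nu>\<close> is the directional derivative in direction \<open>\<nu> - \<mu>\<close>, and \<open>D\<close> is a continuous, positively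
  homogeneous extension of \<open>\<nu> - \<mu> \<mapsto> \<delta>' \<nu>\<close> to the tangent cone. Values of \<open>D\<close> off the cone are
  irrelevant.\<close>

definition tangent_extension ::
  "('a \<Rightarrow> real) set \<Rightarrow> 'a measure set \<Rightarrow> 'a measure \<Rightarrow> ('a measure \<Rightarrow> 'e::real_normed_vector)
     \<Rightarrow> ((('a \<Rightarrow> real) \<Rightarrow> real) \<Rightarrow> 'e) \<Rightarrow> bool" where
  "tangent_extension \<F> P0 \<mu> \<delta>' D \<longleftrightarrow>
     (\<forall>\<nu>\<in>P0. D (meas_diff \<F> \<nu> \<mu>) = \<delta>' \<nu>) \<and>
     continuous_map (subtopology (mtopology_of (linf \<F>)) (tangent_cone \<F> P0 \<mu>)) euclidean D \<and>
     (\<forall>z\<in>tangent_cone \<F> P0 \<mu>. \<forall>t>0. D (linf_scale \<F> t z) = t *\<^sub>R D z)"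

end

theory Submission
  imports Defs
begin

text \<open>
  Write \<open>X\<^sub>n = \<surd>n (\<mu>\<^sub>n - \<mu>)\<close> and \<open>W\<^sub>n = \<surd>n (\<delta>(\<mu>\<^sub>n) - \<delta>(\<mu>))\<close>, and let \<open>T\<close> be the tangent cone.

  On the (not yet closed) cone of directions \<open>t (\<nu> - \<mu>)\<close> the value \<open>t \<delta>'(\<nu>)\<close> is the limit, as
  \<open>s \<rightarrow> \<infinity>\<close>, of \<open>s (\<delta>(\<mu> + (t/s) (\<nu> - \<mu>)) - \<delta>(\<mu>))\<close>. At every fixed scale \<open>s\<close> these increments inherit
  from \<open>\<delta>\<close> the Lipschitz constant \<open>C\<close>, in a region that grows with \<open>s\<close>, so the limit is
  \<open>C\<close>-Lipschitz (lemma \<open>cone_Lipschitz\<close>). Hence it depends only on the direction and not on its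
  representation by \<open>t\<close> and \<open>\<nu>\<close>, and since the target is complete it extends to a Lipschitz map
  \<open>D\<close> on the closure \<open>T\<close>; uniqueness and positive homogeneity pass to \<open>T\<close> by density.

  The same equi-Lipschitz property makes the convergence of increments uniform: for large \<open>n\<close>,
  \<open>W\<^sub>n\<close> is within \<open>\<eta>\<close> of \<open>D(X\<^sub>n)\<close> as soon as \<open>X\<^sub>n\<close> lies in some neighbourhood of a given compact
  \<open>K \<subseteq> T\<close>, because finitely many directions of the cone approximate all of \<open>K\<close> (lemma
  \<open>increment_approx_near_compact\<close>).

  The probabilistic part uses the capped distance to a set as test function. Every \<open>X\<^sub>n\<close> lies in the closed set \<open>T\<close>, hence so does
  the limit \<open>G\<close>, almost surely (\<open>limit_in_closed\<close>). By tightness \<open>G\<close> lies in a compact \<open>K \<subseteq> T\<close> up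
  to probability \<open>e\<close>, so \<open>X\<^sub>n\<close> lies near \<open>K\<close> up to outer probability about \<open>e\<close>, and there \<open>W\<^sub>n\<close> is
  close to \<open>D(X\<^sub>n)\<close> (\<open>conv_outer_prob_0_diff\<close>). For the limit law of \<open>W\<^sub>n\<close>, a bounded continuous
  \<open>h\<close> gives a continuous \<open>h \<circ> D\<close> on \<open>T\<close>, which Tietze's theorem extends to a bounded continuous
  function on the whole space; \<open>h(W\<^sub>n)\<close> is then squeezed between two bounded continuous functions
  of \<open>X\<^sub>n\<close> (\<open>HJ_conv_in_dist_approx\<close>).
\<close>


section \<open>Distance to a set and uniform continuity near a compact set\<close>

text \<open>The cap \<open>r\<close> makes the distance to \<open>A\<close> a bounded function, which may be inserted into the
  definition of convergence in distribution. For \<open>A = {}\<close> the value is \<open>r\<close>, so that no case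
  distinction on emptiness of compact sets arises below.\<close>

definition capped_setdist :: "'a metric \<Rightarrow> real \<Rightarrow> 'a set \<Rightarrow> 'a \<Rightarrow> real" where
  "capped_setdist m r A z = Inf (insert r (mdist m z ` A))"

lemma bdd_below_dists: "bdd_below (insert r (mdist m z ` A))"
proof -
  interpret Metric_space "mspace m" "mdist m" by simp
  show ?thesis by (rule bdd_belowI [of _ "min r 0"]) (auto simp: min_le_iff_disj)
qed

lemma capped_setdist_le: "capped_setdist m r A z \<le> r"
  unfolding capped_setdist_def by (rule cInf_lower [OF _ bdd_below_dists]) simp

lemma capped_setdist_le_mdist: "a \<in> A \<Longrightarrow> capped_setdist m r A z \<le> mdist m z a"
  unfolding capped_setdist_def by (rule cInf_lower [OF _ bdd_below_dists]) simp

lemma capped_setdist_nonneg: "0 \<le> r \<Longrightarrow> 0 \<le> capped_setdist m r A z"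
proof -
  interpret Metric_space "mspace m" "mdist m" by simp
  assume "0 \<le> r" then show ?thesis
    unfolding capped_setdist_def by (intro cInf_greatest) auto
qed

lemma capped_setdist_lessD:
  assumes "capped_setdist m r A z < s" "s \<le> r"
  shows "\<exists>a\<in>A. mdist m z a < s"
  using cInf_lessD [OF _ assms(1) [unfolded capped_setdist_def]] assms(2) by fastforce

lemma capped_setdist_eq_0:
  assumes "z \<in> A" "z \<in> mspace m" "0 \<le> r"
  shows "capped_setdist m r A z = 0"
proof -
  interpret Metric_space "mspace m" "mdist m" by simp
  show ?thesis
    using capped_setdist_le_mdist [OF assms(1), of m r z] capped_setdist_nonneg [OF assms(3), of m A z]
      assms(2) by simp
qed

lemma capped_setdist_eq_0_imp_closure:
  assumes "A \<subseteq> mspace m" "z \<in> mspace m" "0 < r" "capped_setdist m r A z = 0"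
  shows "z \<in> mtopology_of m closure_of A"
proof -
  interpret Metric_space "mspace m" "mdist m" by simp
  have "\<exists>a\<in>A. a \<in> mball z s" if "0 < s" for s
    using capped_setdist_lessD [of m r A z "min r s"] assms that by fastforce
  then show ?thesis
    using assms(2) unfolding mtopology_of_def metric_closure_of by blast
qed

text \<open>By the triangle inequality, taking the infimum preserves the Lipschitz constant 1 of the
  distances to the points of \<open>A\<close>.\<close>

lemma continuous_map_capped_setdist:
  assumes "A \<subseteq> mspace m"
  shows "continuous_map (mtopology_of m) euclideanreal (capped_setdist m r A)"
proof -
  interpret Metric_space "mspace m" "mdist m" by simp
  have le: "capped_setdist m r A x \<le> capped_setdist m r A y + mdist m x y"
    if "x \<in> mspace m" "y \<in> mspace m" for x y
  proof -
    have "capped_setdist m r A x - mdist m x y \<le> capped_setdist m r A y"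
      unfolding capped_setdist_def [of m r A y]
    proof (rule cInf_greatest)
      fix s assume "s \<in> insert r (mdist m y ` A)"
      then consider "s = r" | a where "a \<in> A" "s = mdist m y a" by auto
      then show "capped_setdist m r A x - mdist m x y \<le> s"
      proof cases
        case 1
        then show ?thesis using capped_setdist_le [of m r A x] nonneg [of x y] by linarith
      next
        case 2
        then show ?thesis
          using capped_setdist_le_mdist [of a A m r x] triangle [of x y a] that assms by fastforce
      qed
    qed simp
    then show ?thesis by simp
  qed
  have "Lipschitz_continuous_map m euclidean_metric (capped_setdist m r A)"
    unfolding Lipschitz_continuous_map_def
  proof (intro conjI exI [of _ 1] ballI)
    fix x y assume "x \<in> mspace m" "y \<in> mspace m"
    then show "mdist euclidean_metric (capped_setdist m r A x) (capped_setdist m r A y) \<le> 1 * mdist m x y"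
      using le [of x y] le [of y x] by (simp add: dist_real_def commute)
  qed auto
  then show ?thesis
    using Lipschitz_continuous_imp_continuous_map by fastforce
qed

text \<open>The Heine-Cantor theorem in the form that convergence towards a compact set requires: only
  \<open>k\<close> is confined to \<open>K\<close>, while \<open>x\<close> may be any nearby point of \<open>T\<close>. The number \<open>r\<close> is a
  Lebesgue number of the cover of \<open>K\<close> by preimages of balls.\<close>

lemma continuous_map_uniform_near_compact:
  fixes f :: "'a \<Rightarrow> 'b::metric_space"
  assumes K: "compactin (mtopology_of m) K" "K \<subseteq> T"
    and f: "continuous_map (subtopology (mtopology_of m) T) euclidean f"
    and "0 < e"
  obtains r where "0 < r"
    "\<And>k x. k \<in> K \<Longrightarrow> x \<in> T \<Longrightarrow> x \<in> mspace m \<Longrightarrow> mdist m x k < r \<Longrightarrow> dist (f x) (f k) < e"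
proof -
  interpret Metric_space "mspace m" "mdist m" by simp
  have K': "compactin mtopology K" using K by (simp add: mtopology_of_def)
  have Km: "K \<subseteq> mspace m" using compactin_subset_topspace [OF K'] by simp
  have "\<exists>U. openin mtopology U \<and> U \<inter> T = {x \<in> mspace m \<inter> T. f x \<in> ball (f k) (e/2)}" for k
  proof -
    have "openin (subtopology (mtopology_of m) T) {x \<in> topspace (subtopology (mtopology_of m) T). f x \<in> ball (f k) (e/2)}"
      by (rule openin_continuous_map_preimage [OF f]) simp
    then show ?thesis
      unfolding openin_subtopology by (auto simp: mtopology_of_def)
  qed
  then obtain U where U: "\<And>k. openin mtopology (U k)"
      "\<And>k. U k \<inter> T = {x \<in> mspace m \<inter> T. f x \<in> ball (f k) (e/2)}"
    by metis
  have "K \<subseteq> \<Union> (U ` K)"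
  proof
    fix k assume k: "k \<in> K"
    then have "k \<in> U k \<inter> T" unfolding U(2) using Km K \<open>0 < e\<close> by auto
    with k show "k \<in> \<Union> (U ` K)" by auto
  qed
  from lebesgue_number [OF K' this] U(1)
  have "\<exists>r>0. \<forall>x\<in>K. \<exists>k\<in>K. mball x r \<subseteq> U k" by auto
  then obtain r where r: "0 < r" "\<And>x. x \<in> K \<Longrightarrow> \<exists>k\<in>K. mball x r \<subseteq> U k"
    by blast
  show thesis
  proof (rule that [OF r(1)])
    fix k x assume *: "k \<in> K" "x \<in> T" "x \<in> mspace m" "mdist m x k < r"
    then obtain k' where k': "k' \<in> K" "mball k r \<subseteq> U k'" using r by blast
    moreover have "x \<in> mball k r" "k \<in> mball k r" using * Km r(1) by (auto simp: commute)
    ultimately have "x \<in> U k' \<inter> T" "k \<in> U k' \<inter> T" using * K by blast+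
    then have "dist (f k') (f x) < e/2" "dist (f k') (f k) < e/2" unfolding U(2) by auto
    then show "dist (f x) (f k) < e"
      by (rule dist_triangle_half_r)
  qed
qed


section \<open>Outer expectations\<close>

lemma lower_bound_le_majorant_integral:
  fixes T :: "'w \<Rightarrow> real"
  assumes "prob_space M" "\<And>\<omega>. \<omega> \<in> space M \<Longrightarrow> a \<le> T \<omega>"
    "integrable M u" "\<forall>\<omega>\<in>space M. T \<omega> \<le> u \<omega>"
  shows "a \<le> integral\<^sup>L M u"
proof -
  interpret prob_space M by fact
  have "(\<integral>\<omega>. a \<partial>M) \<le> integral\<^sup>L M u"
    using assms by (intro integral_mono) (auto intro: order_trans)
  then show ?thesis by (simp add: prob_space)
qed

text \<open>The bound \<open>a\<close> keeps the integrals of the majorants of \<open>T\<close> bounded below, and \<open>b\<close> provides a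
  majorant of \<open>T'\<close>; without such bounds the infima in the definition could be meaningless.\<close>

lemma outer_expectation_mono_add:
  assumes M: "prob_space M"
    and bnd: "\<And>\<omega>. \<omega> \<in> space M \<Longrightarrow> a \<le> T \<omega>" "\<And>\<omega>. \<omega> \<in> space M \<Longrightarrow> T' \<omega> \<le> b"
    and le: "\<And>\<omega>. \<omega> \<in> space M \<Longrightarrow> T \<omega> \<le> T' \<omega> + c"
  shows "outer_expectation M T \<le> outer_expectation M T' + c"
proof -
  interpret prob_space M by fact
  have "outer_expectation M T - c \<le> outer_expectation M T'"
    unfolding outer_expectation_def [of M T']
  proof (rule cInf_greatest)
    show "{integral\<^sup>L M u |u. integrable M u \<and> (\<forall>\<omega>\<in>space M. T' \<omega> \<le> u \<omega>)} \<noteq> {}"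
      using bnd(2) by (auto intro!: exI [of _ "\<lambda>_. b"])
    fix s assume "s \<in> {integral\<^sup>L M u |u. integrable M u \<and> (\<forall>\<omega>\<in>space M. T' \<omega> \<le> u \<omega>)}"
    then obtain u where u: "integrable M u" "\<forall>\<omega>\<in>space M. T' \<omega> \<le> u \<omega>" "s = integral\<^sup>L M u"
      by blast
    have "outer_expectation M T \<le> integral\<^sup>L M (\<lambda>\<omega>. u \<omega> + c)"
      unfolding outer_expectation_def
    proof (rule cInf_lower)
      show "bdd_below {integral\<^sup>L M u |u. integrable M u \<and> (\<forall>\<omega>\<in>space M. T \<omega> \<le> u \<omega>)}"
        using lower_bound_le_majorant_integral [OF M, of a T] bnd(1) by (intro bdd_belowI [of _ a]) blast
      show "integral\<^sup>L M (\<lambda>\<omega>. u \<omega> + c)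
          \<in> {integral\<^sup>L M u |u. integrable M u \<and> (\<forall>\<omega>\<in>space M. T \<omega> \<le> u \<omega>)}"
        using u le by (fastforce intro!: exI [of _ "\<lambda>\<omega>. u \<omega> + c"])
    qed
    also have "\<dots> = s + c" using u by (simp add: prob_space)
    finally show "outer_expectation M T - c \<le> s" by simp
  qed
  then show ?thesis by simp
qed

lemma outer_expectation_const:
  assumes "prob_space M" "\<And>\<omega>. \<omega> \<in> space M \<Longrightarrow> T \<omega> = c"
  shows "outer_expectation M T = c"
proof -
  interpret prob_space M by fact
  show ?thesis unfolding outer_expectation_def
  proof (rule cInf_eq_minimum)
    show "c \<in> {integral\<^sup>L M u |u. integrable M u \<and> (\<forall>\<omega>\<in>space M. T \<omega> \<le> u \<omega>)}"
      using assms(2) by (auto intro!: exI [of _ "\<lambda>_. c"] simp: prob_space)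
  qed (use lower_bound_le_majorant_integral [OF assms(1), of c T] assms(2) in auto)
qed

text \<open>Markov's inequality: it holds for each integrable majorant of \<open>T\<close>, and the outer expectation
  is the infimum of their integrals.\<close>

lemma outer_measure_le_outer_expectation:
  assumes M: "prob_space M"
    and bnd: "\<And>\<omega>. \<omega> \<in> space M \<Longrightarrow> 0 \<le> T \<omega>" "\<And>\<omega>. \<omega> \<in> space M \<Longrightarrow> T \<omega> \<le> b"
    and "0 < c"
  shows "outer_measure_of M {\<omega> \<in> space M. c \<le> T \<omega>} \<le> ennreal (outer_expectation M T / c)"
proof -
  interpret prob_space M by fact
  define p where "p = outer_measure_of M {\<omega> \<in> space M. c \<le> T \<omega>}"
  have p: "p \<le> ennreal (integral\<^sup>L M u / c)"
    if u: "integrable M u" "\<forall>\<omega>\<in>space M. T \<omega> \<le> u \<omega>" for u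
  proof -
    have [measurable]: "u \<in> borel_measurable M" using u by auto
    have "p \<le> outer_measure_of M {\<omega> \<in> space M. c \<le> u \<omega>}"
      unfolding p_def using u by (intro outer_measure_of_mono) force
    also have "\<dots> = emeasure M {\<omega> \<in> space M. c \<le> u \<omega>}" by simp
    also have "\<dots> = ennreal (measure M {\<omega> \<in> space M. c \<le> u \<omega>})"
      by (rule emeasure_eq_measure)
    also have "\<dots> \<le> ennreal (integral\<^sup>L M u / c)"
      using u bnd \<open>0 < c\<close>
      by (intro ennreal_leI integral_Markov_inequality_measure [where A = "{}"] AE_I2) force+
    finally show ?thesis .
  qed
  have pfin: "p \<noteq> top"
    using p [of "\<lambda>_. b"] bnd by (auto simp: top_unique)
  have "c * enn2real p \<le> outer_expectation M T"
    unfolding outer_expectation_def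
  proof (rule cInf_greatest)
    show "{integral\<^sup>L M u |u. integrable M u \<and> (\<forall>\<omega>\<in>space M. T \<omega> \<le> u \<omega>)} \<noteq> {}"
      using bnd(2) by (auto intro!: exI [of _ "\<lambda>_. b"])
    fix s assume "s \<in> {integral\<^sup>L M u |u. integrable M u \<and> (\<forall>\<omega>\<in>space M. T \<omega> \<le> u \<omega>)}"
    then obtain u where u: "integrable M u" "\<forall>\<omega>\<in>space M. T \<omega> \<le> u \<omega>" "s = integral\<^sup>L M u"
      by blast
    have "0 \<le> s" using lower_bound_le_majorant_integral [OF M bnd(1) u(1,2)] u(3) by simp
    then have "enn2real p \<le> s / c"
      using p [OF u(1,2)] u(3) \<open>0 < c\<close> by (intro enn2real_leI) auto
    then show "c * enn2real p \<le> s" using \<open>0 < c\<close> by (simp add: field_simps)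
  qed
  then have "enn2real p \<le> outer_expectation M T / c" using \<open>0 < c\<close> by (simp add: field_simps)
  then show ?thesis
    unfolding p_def [symmetric] using pfin by (metis ennreal_enn2real ennreal_leI less_top)
qed


section \<open>Convergence in distribution inside a closed set\<close>

lemma space_borel_of_topology: "space (borel_of_topology X) = topspace X"
  unfolding borel_of_topology_def by (rule space_measure_of) (auto dest: openin_subset)

lemma sets_borel_of_topology: "sets (borel_of_topology X) = sigma_sets (topspace X) {U. openin X U}"
  unfolding borel_of_topology_def by (rule sets_measure_of) (auto dest: openin_subset)

lemma openin_in_borel_of_topology: "openin X U \<Longrightarrow> U \<in> sets (borel_of_topology X)"
  unfolding sets_borel_of_topology by (rule sigma_sets.Basic) simp

lemma closedin_in_borel_of_topology:
  assumes "closedin X C" shows "C \<in> sets (borel_of_topology X)"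
proof -
  have "space (borel_of_topology X) - (topspace X - C) \<in> sets (borel_of_topology X)"
    using assms by (intro sets.compl_sets openin_in_borel_of_topology) auto
  moreover have "space (borel_of_topology X) - (topspace X - C) = C"
    using assms closedin_subset unfolding space_borel_of_topology by blast
  ultimately show ?thesis by simp
qed

lemma continuous_map_borel_of_topology:
  fixes h :: "'a \<Rightarrow> 'b::topological_space"
  assumes "continuous_map X euclidean h"
  shows "h \<in> borel_measurable (borel_of_topology X)"
proof (rule borel_measurableI)
  fix S :: "'b set" assume "open S"
  then have "openin X {x \<in> topspace X. h x \<in> S}"
    using openin_continuous_map_preimage [OF assms] by simp
  moreover have "{x \<in> topspace X. h x \<in> S} = h -` S \<inter> space (borel_of_topology X)"
    by (auto simp: space_borel_of_topology)
  ultimately show "h -` S \<inter> space (borel_of_topology X) \<in> sets (borel_of_topology X)"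
    using openin_in_borel_of_topology by metis
qed

lemma borel_of_topology_euclidean: "borel_of_topology euclidean = borel"
  unfolding borel_of_topology_def borel_def by simp

text \<open>The situation of the random elements \<open>\<surd>n (\<mu>\<^sub>n - \<mu>)\<close>, which all take values in the tangent
  cone.\<close>

locale HJ_limit_in_closed =
  fixes m :: "'a metric" and T :: "'a set"
    and P :: "'w measure" and X :: "nat \<Rightarrow> 'w \<Rightarrow> 'a"
    and Q :: "'v measure" and G :: "'v \<Rightarrow> 'a"
  assumes P: "prob_space P" and Q: "prob_space Q"
    and closed: "closedin (mtopology_of m) T"
    and X_in: "\<And>n \<omega>. \<omega> \<in> space P \<Longrightarrow> X n \<omega> \<in> T"
    and conv: "HJ_conv_in_dist P (mtopology_of m) X Q G"
    and tight: "tight_rv Q (mtopology_of m) G"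
begin

interpretation P: prob_space P by (rule P)
interpretation Q: prob_space Q by (rule Q)
interpretation Metric_space "mspace m" "mdist m" by simp

lemma T_subset: "T \<subseteq> mspace m"
  using closedin_subset [OF closed] by simp

lemma G_measurable [measurable]: "G \<in> measurable Q (borel_of_topology (mtopology_of m))"
  using tight by (simp add: tight_rv_def)

lemma G_in: "v \<in> space Q \<Longrightarrow> G v \<in> mspace m"
  using measurable_space [OF G_measurable] by (simp add: space_borel_of_topology)

lemma continuous_o_G:
  fixes h :: "'a \<Rightarrow> 'b::topological_space"
  assumes "continuous_map (mtopology_of m) euclidean h"
  shows "(\<lambda>v. h (G v)) \<in> borel_measurable Q"
  using measurable_compose [OF G_measurable continuous_map_borel_of_topology [OF assms]] .

lemma conv_bounded:
  assumes "continuous_map (mtopology_of m) euclideanreal h" "bounded (h ` mspace m)"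
  shows "(\<lambda>n. outer_expectation P (\<lambda>\<omega>. h (X n \<omega>))) \<longlonglongrightarrow> (\<integral>v. h (G v) \<partial>Q)"
  using conv assms unfolding HJ_conv_in_dist_def by simp

lemma bounded_capped: "0 \<le> r \<Longrightarrow> bounded (capped_setdist m r A ` S)"
  using capped_setdist_le [of m r A] capped_setdist_nonneg [of r m A]
  by (intro boundedI [of _ r]) auto

text \<open>The capped distance to \<open>T\<close> is a bounded continuous test function that vanishes at every
  \<open>X\<^sub>n\<close>. Its expectation at \<open>G\<close> is therefore \<open>0\<close>, and as \<open>T\<close> is closed, distance \<open>0\<close> means
  membership.\<close>

lemma limit_in_closed: "AE v in Q. G v \<in> T"
proof -
  let ?d = "capped_setdist m 1 T"
  have cont: "continuous_map (mtopology_of m) euclideanreal ?d"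
    by (rule continuous_map_capped_setdist [OF T_subset])
  have "outer_expectation P (\<lambda>\<omega>. ?d (X n \<omega>)) = 0" for n
    using X_in T_subset by (intro outer_expectation_const [OF P] capped_setdist_eq_0) auto
  then have "(\<integral>v. ?d (G v) \<partial>Q) = 0"
    using conv_bounded [OF cont bounded_capped] by (simp add: LIMSEQ_const_iff)
  moreover have "integrable Q (\<lambda>v. ?d (G v))"
    using continuous_o_G [OF cont] capped_setdist_le [of m 1 T] capped_setdist_nonneg [of 1 m T]
    by (intro Q.integrable_const_bound [of _ 1]) auto
  ultimately have "AE v in Q. ?d (G v) = 0"
    using capped_setdist_nonneg [of 1 m T]
    by (subst (asm) integral_nonneg_eq_0_iff_AE) auto
  then show ?thesis
    using AE_space
  proof eventually_elim
    case (elim v)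
    then have "G v \<in> mtopology_of m closure_of T"
      using T_subset G_in by (intro capped_setdist_eq_0_imp_closure [of _ _ _ 1]) auto
    then show ?case using closed by (simp add: closure_of_closedin)
  qed
qed

text \<open>Tightness inside \<open>T\<close>, expressed by the test functions: the capped distance to \<open>K\<close> vanishes
  where \<open>G \<in> K\<close> and is at most \<open>r\<close> on the remaining event of probability at most \<open>e\<close>. This form
  transfers directly to the outer expectations of the \<open>X\<^sub>n\<close>.\<close>

lemma tight_within:
  assumes "0 < e"
  obtains K where "compactin (mtopology_of m) K" "K \<subseteq> T"
    "\<And>r. 0 \<le> r \<Longrightarrow> (\<integral>v. capped_setdist m r K (G v) \<partial>Q) \<le> r * e"
proof -
  obtain K where K: "compactin (mtopology_of m) K" "K \<in> sets (borel_of_topology (mtopology_of m))"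
    "1 - e \<le> measure Q {v \<in> space Q. G v \<in> K}"
    using tight assms unfolding tight_rv_def by blast
  show thesis
  proof (rule that [of "K \<inter> T"])
    show "compactin (mtopology_of m) (K \<inter> T)"
      using closed K(1) by (simp add: compact_Int_closedin)
    fix r :: real assume "0 \<le> r"
    let ?A = "{v \<in> space Q. G v \<in> K}" and ?d = "capped_setdist m r (K \<inter> T)"
    have A: "?A \<in> sets Q" using K(2) by measurable
    have cont: "continuous_map (mtopology_of m) euclideanreal ?d"
      using T_subset by (intro continuous_map_capped_setdist) auto
    have "(\<integral>v. ?d (G v) \<partial>Q) \<le> (\<integral>v. r * indicator (space Q - ?A) v \<partial>Q)"
    proof (rule integral_mono_AE)
      show "integrable Q (\<lambda>v. ?d (G v))"
        using continuous_o_G [OF cont] capped_setdist_le [of m r] capped_setdist_nonneg [OF \<open>0 \<le> r\<close>, of m]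
        by (intro Q.integrable_const_bound [of _ r]) auto
      show "integrable Q (\<lambda>v. r * indicator (space Q - ?A) v)"
        using A by (intro integrable_mult_right) (simp add: integrable_real_indicator Q.emeasure_eq_measure)
      show "AE v in Q. ?d (G v) \<le> r * indicator (space Q - ?A) v"
        using limit_in_closed AE_space
      proof eventually_elim
        case (elim v)
        then show ?case
          using capped_setdist_eq_0 [of "G v" "K \<inter> T" m r] \<open>0 \<le> r\<close> G_in capped_setdist_le [of m r]
          by (cases "G v \<in> K") auto
      qed
    qed
    also have "\<dots> = r * (1 - measure Q ?A)"
      using A by (simp add: Q.prob_compl)
    also have "\<dots> \<le> r * e" using K(3) \<open>0 \<le> r\<close> by (intro mult_left_mono) auto
    finally show "(\<integral>v. ?d (G v) \<partial>Q) \<le> r * e" .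
  qed auto
qed

end

text \<open>Assumption \<open>approx\<close> says that \<open>W\<^sub>n\<close> is asymptotically \<open>D(X\<^sub>n)\<close>, uniformly over those \<open>\<omega>\<close>
  for which \<open>X\<^sub>n\<close> lies in a neighbourhood of \<open>K\<close>. A neighbourhood is essential: convergence in
  distribution brings \<open>X\<^sub>n\<close> close to the compact sets that carry \<open>G\<close>, but not into them. The
  conclusions amount to an extended continuous mapping theorem.\<close>

locale HJ_limit_approx = HJ_limit_in_closed m T P X Q G
  for m :: "'a metric" and T :: "'a set"
    and P :: "'w measure" and X :: "nat \<Rightarrow> 'w \<Rightarrow> 'a"
    and Q :: "'v measure" and G :: "'v \<Rightarrow> 'a" +
  fixes D :: "'a \<Rightarrow> 'e::real_normed_vector" and W :: "nat \<Rightarrow> 'w \<Rightarrow> 'e"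
  assumes D_cont: "continuous_map (subtopology (mtopology_of m) T) euclidean D"
    and approx: "\<And>K \<eta>. compactin (mtopology_of m) K \<Longrightarrow> K \<subseteq> T \<Longrightarrow> 0 < \<eta> \<Longrightarrow>
      \<exists>N r. 0 < r \<and> (\<forall>n\<ge>N. \<forall>\<omega>\<in>space P. (\<exists>k\<in>K. mdist m (X n \<omega>) k < r)
        \<longrightarrow> norm (W n \<omega> - D (X n \<omega>)) \<le> \<eta>)"
begin

interpretation P: prob_space P by (rule P)
interpretation Q: prob_space Q by (rule Q)
interpretation Metric_space "mspace m" "mdist m" by simp

text \<open>A deviation larger than \<open>\<eta>\<close> forces \<open>X\<^sub>n\<close> to have distance at least \<open>r\<close> from \<open>K\<close>, that is,
  the capped distance to be maximal. Markov's inequality bounds the outer probability of this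
  event, and the bounding outer expectations converge to a small limit.\<close>

lemma conv_outer_prob_0_diff: "conv_outer_prob_0 P (\<lambda>n \<omega>. W n \<omega> - D (X n \<omega>))"
  unfolding conv_outer_prob_0_def
proof (intro allI impI)
  fix \<eta> :: real assume "0 < \<eta>"
  let ?p = "\<lambda>n. outer_measure_of P {\<omega> \<in> space P. norm (W n \<omega> - D (X n \<omega>)) > \<eta>}"
  have small: "\<forall>\<^sub>F n in sequentially. ?p n \<le> ennreal e" if "0 < e" for e
  proof -
    obtain K where K: "compactin (mtopology_of m) K" "K \<subseteq> T"
      "\<And>r. 0 \<le> r \<Longrightarrow> (\<integral>v. capped_setdist m r K (G v) \<partial>Q) \<le> r * (e/2)"
      using tight_within [of "e/2"] \<open>0 < e\<close> by auto
    obtain N r where r: "0 < r" and N: "\<And>n \<omega>. n \<ge> N \<Longrightarrow> \<omega> \<in> space P \<Longrightarrow>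
        \<exists>k\<in>K. mdist m (X n \<omega>) k < r \<Longrightarrow> norm (W n \<omega> - D (X n \<omega>)) \<le> \<eta>"
      using approx [OF K(1,2) \<open>0 < \<eta>\<close>] by blast
    let ?d = "capped_setdist m r K"
    have "(\<lambda>n. outer_expectation P (\<lambda>\<omega>. ?d (X n \<omega>))) \<longlonglongrightarrow> (\<integral>v. ?d (G v) \<partial>Q)"
      using r K(2) T_subset by (intro conv_bounded continuous_map_capped_setdist bounded_capped) auto
    moreover have "(\<integral>v. ?d (G v) \<partial>Q) < r * e"
      using K(3) [of r] r \<open>0 < e\<close> by (rule_tac le_less_trans [of _ "r * (e/2)"]) auto
    ultimately have "\<forall>\<^sub>F n in sequentially. outer_expectation P (\<lambda>\<omega>. ?d (X n \<omega>)) < r * e"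
      by (rule order_tendstoD)
    then show ?thesis
      using eventually_ge_at_top [of N]
    proof eventually_elim
      case (elim n)
      have "?p n \<le> outer_measure_of P {\<omega> \<in> space P. r \<le> ?d (X n \<omega>)}"
      proof (intro outer_measure_of_mono subsetI)
        fix \<omega> assume \<omega>: "\<omega> \<in> {\<omega> \<in> space P. norm (W n \<omega> - D (X n \<omega>)) > \<eta>}"
        then have "\<not> ?d (X n \<omega>) < r"
          using N [OF elim(2), of \<omega>] capped_setdist_lessD [of m r K _ r] by fastforce
        with \<omega> show "\<omega> \<in> {\<omega> \<in> space P. r \<le> ?d (X n \<omega>)}" by simp
      qed
      also have "\<dots> \<le> ennreal (outer_expectation P (\<lambda>\<omega>. ?d (X n \<omega>)) / r)"
        using r by (intro outer_measure_le_outer_expectation [OF P])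
          (auto intro: capped_setdist_nonneg capped_setdist_le)
      also have "\<dots> \<le> ennreal e"
        using elim(1) r by (intro ennreal_leI) (simp add: field_simps)
      finally show ?case .
    qed
  qed
  show "?p \<longlonglongrightarrow> 0"
  proof (rule order_tendstoI)
    fix a :: ennreal assume "0 < a"
    then obtain e where "0 < e" "e < a" using dense by blast
    then have "e < top" by (meson less_le_trans top_greatest)
    then have "0 < enn2real e" "ennreal (enn2real e) = e"
      using \<open>0 < e\<close> by (simp_all add: enn2real_positive_iff)
    then have "\<forall>\<^sub>F n in sequentially. ?p n \<le> e"
      using small [of "enn2real e"] by metis
    then show "\<forall>\<^sub>F n in sequentially. ?p n < a"
      by (rule eventually_mono) (rule le_less_trans [OF _ \<open>e < a\<close>])
  next
    fix a :: ennreal assume "a < 0"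
    then have False by (rule not_less_zero [THEN notE])
    then show "\<forall>\<^sub>F n in sequentially. a < ?p n" ..
  qed
qed

lemma measurable_limit:
  "(\<lambda>v. if G v \<in> T then D (G v) else 0) \<in> borel_measurable Q"
proof (rule borel_measurableI)
  fix S :: "'e set" assume "open S"
  then have "openin (subtopology (mtopology_of m) T)
      {x \<in> topspace (subtopology (mtopology_of m) T). D x \<in> S}"
    by (intro openin_continuous_map_preimage [OF D_cont]) simp
  then obtain U where U: "openin (mtopology_of m) U" "{x \<in> T. D x \<in> S} = U \<inter> T"
    using T_subset unfolding openin_subtopology by (auto simp: Int_absorb1)
  have [measurable]: "U \<in> sets (borel_of_topology (mtopology_of m))"
      "T \<in> sets (borel_of_topology (mtopology_of m))"
    using U closed by (auto intro: openin_in_borel_of_topology closedin_in_borel_of_topology)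
  have "D z \<in> S \<longleftrightarrow> z \<in> U" if "z \<in> T" for z
    using U(2) that by blast
  then have "(\<lambda>v. if G v \<in> T then D (G v) else 0) -` S \<inter> space Q
      = {v \<in> space Q. (G v \<in> U \<and> G v \<in> T) \<or> (G v \<notin> T \<and> 0 \<in> S)}"
    by (auto split: if_splits)
  also have "\<dots> \<in> sets Q" by measurable
  finally show "(\<lambda>v. if G v \<in> T then D (G v) else 0) -` S \<inter> space Q \<in> sets Q" .
qed

text \<open>A continuous \<open>h\<close> need not be uniformly continuous, but near the compact image \<open>D ` K\<close> it
  behaves as if it were, and both \<open>W\<^sub>n\<close> and \<open>D(X\<^sub>n)\<close> come near \<open>D ` K\<close>.\<close>

lemma approx_continuous:
  fixes h :: "'e \<Rightarrow> real"
  assumes K: "compactin (mtopology_of m) K" "K \<subseteq> T" and "continuous_on UNIV h" "0 < \<eta>"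
  obtains N r where "0 < r"
    "\<And>n \<omega>. n \<ge> N \<Longrightarrow> \<omega> \<in> space P \<Longrightarrow> \<exists>k\<in>K. mdist m (X n \<omega>) k < r
      \<Longrightarrow> \<bar>h (W n \<omega>) - h (D (X n \<omega>))\<bar> \<le> \<eta>"
proof -
  have "compactin (subtopology (mtopology_of m) T) K"
    using K by (simp add: compactin_subtopology)
  then have "compactin (mtopology_of euclidean_metric) (D ` K)"
    using image_compactin D_cont by fastforce
  moreover have "continuous_map (subtopology (mtopology_of euclidean_metric) UNIV) euclidean h"
    using assms by simp
  ultimately obtain s where s: "0 < s"
    "\<And>a b. a \<in> D ` K \<Longrightarrow> dist b a < s \<Longrightarrow> dist (h b) (h a) < \<eta>/2"
    using continuous_map_uniform_near_compact [of euclidean_metric "D ` K" UNIV h "\<eta>/2"] \<open>0 < \<eta>\<close>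
    by auto
  obtain r1 where r1: "0 < r1"
    "\<And>k x. k \<in> K \<Longrightarrow> x \<in> T \<Longrightarrow> mdist m x k < r1 \<Longrightarrow> dist (D x) (D k) < s/2"
    using continuous_map_uniform_near_compact [OF K D_cont, of "s/2"] T_subset s(1)
    by (metis half_gt_zero subsetD)
  obtain N r2 where r2: "0 < r2" "\<And>n \<omega>. n \<ge> N \<Longrightarrow> \<omega> \<in> space P \<Longrightarrow>
      \<exists>k\<in>K. mdist m (X n \<omega>) k < r2 \<Longrightarrow> norm (W n \<omega> - D (X n \<omega>)) \<le> s/3"
    using approx [OF K divide_pos_pos [OF s(1) zero_less_numeral]] by blast
  show thesis
  proof (rule that [of "min r1 r2" N])
    fix n \<omega> assume n: "n \<ge> N" "\<omega> \<in> space P" "\<exists>k\<in>K. mdist m (X n \<omega>) k < min r1 r2"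
    then obtain k where k: "k \<in> K" "mdist m (X n \<omega>) k < r1" "mdist m (X n \<omega>) k < r2" by auto
    have 1: "dist (D (X n \<omega>)) (D k) < s/2" using r1(2) k X_in n by blast
    moreover have "dist (W n \<omega>) (D (X n \<omega>)) \<le> s/3"
      using r2(2) [OF n(1,2)] k by (auto simp: dist_norm)
    ultimately have "dist (W n \<omega>) (D k) < s"
      using dist_triangle [of "W n \<omega>" "D k" "D (X n \<omega>)"] s(1) by linarith
    then have "dist (h (W n \<omega>)) (h (D k)) < \<eta>/2" using s(2) k by blast
    moreover have "dist (h (D (X n \<omega>))) (h (D k)) < \<eta>/2" using s k 1 by auto
    ultimately show "\<bar>h (W n \<omega>) - h (D (X n \<omega>))\<bar> \<le> \<eta>"
      unfolding dist_real_def by linarith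
  qed (use r1 r2 in auto)
qed

text \<open>Outer expectations are not additive, so \<open>h(W\<^sub>n) - h(D(X\<^sub>n))\<close> is not estimated separately.
  Instead \<open>h(W\<^sub>n)\<close> is enclosed between \<open>g \<plusminus> 2 B d\<close> at \<open>X\<^sub>n\<close>, up to a constant, where \<open>g\<close> is a
  Tietze extension of \<open>h \<circ> D\<close> and \<open>d\<close> is the normalised capped distance to \<open>K\<close>. These bounds are
  continuous functions of \<open>X\<^sub>n\<close>, so monotonicity of the outer expectation suffices.\<close>

lemma HJ_conv_in_dist_approx:
  "HJ_conv_in_dist P euclidean W Q (\<lambda>v. if G v \<in> T then D (G v) else 0)"
  unfolding HJ_conv_in_dist_def borel_of_topology_euclidean
proof (intro conjI allI impI)
  fix h :: "'e \<Rightarrow> real"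
  assume h: "continuous_map euclidean euclideanreal h \<and> bounded (h ` topspace euclidean)"
  then have hcont: "continuous_on UNIV h" by simp
  obtain B where B: "\<And>x. \<bar>h x\<bar> \<le> B" using h by (auto simp: bounded_iff)
  then have "0 \<le> B" using abs_ge_zero order_trans by blast
  have "continuous_map (subtopology (mtopology_of m) T) euclideanreal (h \<circ> D)"
    using continuous_map_compose [OF D_cont] h by blast
  moreover have "normal_space (mtopology_of m)"
    using normal_space_mtopology by (simp add: mtopology_of_def)
  moreover have "(h \<circ> D) ` T \<subseteq> {-B..B}"
    using B by (auto simp: abs_le_iff minus_le_iff)
  ultimately obtain g where g: "continuous_map (mtopology_of m) euclideanreal g"
    "g ` mspace m \<subseteq> {-B..B}" "\<And>z. z \<in> T \<Longrightarrow> g z = h (D z)"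
    using Tietze_extension_realinterval [of "mtopology_of m" T "{-B..B}" "h \<circ> D"] closed \<open>0 \<le> B\<close>
    by (auto simp: is_interval_cc)
  let ?I = "\<integral>v. h (if G v \<in> T then D (G v) else 0) \<partial>Q"
  let ?E = "\<lambda>n. outer_expectation P (\<lambda>\<omega>. h (W n \<omega>))"
  have I: "?I = (\<integral>v. g (G v) \<partial>Q)"
  proof (rule integral_cong_AE)
    show "AE v in Q. h (if G v \<in> T then D (G v) else 0) = g (G v)"
      using limit_in_closed by eventually_elim (simp add: g(3))
    show "(\<lambda>v. h (if G v \<in> T then D (G v) else 0)) \<in> borel_measurable Q"
      using measurable_compose [OF measurable_limit borel_measurable_continuous_onI [OF hcont]] .
  qed (rule continuous_o_G [OF g(1)])
  have key: "\<forall>\<^sub>F n in sequentially. \<bar>?E n - ?I\<bar> < e" if "0 < e" for e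
  proof -
    \<comment> \<open>Off the neighbourhood of \<open>K\<close> the error is at most \<open>2 B\<close>; with probability \<open>e1\<close> left for
      that event, this contributes less than \<open>e/2\<close>. The summand \<open>1\<close> covers \<open>B = 0\<close>.\<close>
    define e1 where "e1 = e / (4 * (B + 1))"
    have "0 < e1" using \<open>0 \<le> B\<close> \<open>0 < e\<close> by (simp add: e1_def)
    have e1: "2 * B * e1 < e / 2" using \<open>0 \<le> B\<close> \<open>0 < e\<close> by (simp add: e1_def field_simps)
    obtain K where K: "compactin (mtopology_of m) K" "K \<subseteq> T"
      "\<And>r. 0 \<le> r \<Longrightarrow> (\<integral>v. capped_setdist m r K (G v) \<partial>Q) \<le> r * e1"
      using tight_within [OF \<open>0 < e1\<close>] by auto
    have "0 < e/4" using \<open>0 < e\<close> by simp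
    then obtain N r where r: "0 < r" and N: "\<And>n \<omega>. n \<ge> N \<Longrightarrow> \<omega> \<in> space P \<Longrightarrow>
        \<exists>k\<in>K. mdist m (X n \<omega>) k < r \<Longrightarrow> \<bar>h (W n \<omega>) - h (D (X n \<omega>))\<bar> \<le> e/4"
      using approx_continuous [OF K(1,2) hcont] by metis
    define d where "d = (\<lambda>z. capped_setdist m r K z / r)"
    have d01: "0 \<le> d z" "d z \<le> 1" for z
      using capped_setdist_nonneg [of r m K z] capped_setdist_le [of m r K z] r by (auto simp: d_def)
    have dcont: "continuous_map (mtopology_of m) euclideanreal d"
      unfolding d_def using K(2) T_subset r
      by (intro continuous_map_real_divide continuous_map_capped_setdist) auto
    have dint: "(\<integral>v. d (G v) \<partial>Q) \<le> e1"
      using K(3) [of r] r by (simp add: d_def field_simps)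
    have close: "\<bar>h (W n \<omega>) - g (X n \<omega>)\<bar> \<le> 2 * B * d (X n \<omega>) + e/4"
      if "n \<ge> N" "\<omega> \<in> space P" for n \<omega>
    proof (cases "\<exists>k\<in>K. mdist m (X n \<omega>) k < r")
      case True
      then have "\<bar>h (W n \<omega>) - g (X n \<omega>)\<bar> \<le> e/4"
        using N [OF that] g(3) X_in [OF that(2)] by simp
      moreover have "0 \<le> 2 * B * d (X n \<omega>)" using d01 \<open>0 \<le> B\<close> by simp
      ultimately show ?thesis by linarith
    next
      case False
      then have "\<not> capped_setdist m r K (X n \<omega>) < r"
        using capped_setdist_lessD [of m r K _ r] by blast
      then have "d (X n \<omega>) = 1"
        using capped_setdist_le [of m r K "X n \<omega>"] r by (simp add: d_def)
      moreover have "\<bar>h (W n \<omega>) - g (X n \<omega>)\<bar> \<le> 2 * B"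
        using B [of "W n \<omega>"] B [of "D (X n \<omega>)"] g(3) X_in [OF that(2)] by simp
      ultimately show ?thesis using \<open>0 < e\<close> by simp
    qed
    have gb: "\<bar>g z\<bar> \<le> B" if "z \<in> mspace m" for z using g(2) that by (force simp: abs_le_iff)
    have Xm: "X n \<omega> \<in> mspace m" if "\<omega> \<in> space P" for n \<omega> using X_in that T_subset by blast
    have Bd: "0 \<le> 2 * B * d z" "2 * B * d z \<le> 2 * B" for z
      using d01 [of z] \<open>0 \<le> B\<close> by (auto simp: mult_left_le)
    let ?u = "\<lambda>z. g z + 2 * B * d z" and ?l = "\<lambda>z. g z - 2 * B * d z"
    have bu: "\<bar>?u z\<bar> \<le> 3 * B" "\<bar>?l z\<bar> \<le> 3 * B" if "z \<in> mspace m" for z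
      using gb [OF that] Bd [of z] by linarith+
    have gi: "integrable Q (\<lambda>v. g (G v))"
      using continuous_o_G [OF g(1)] gb G_in by (intro Q.integrable_const_bound [of _ B]) auto
    have di: "integrable Q (\<lambda>v. 2 * B * d (G v))"
      using continuous_o_G [OF dcont] d01 by (intro integrable_mult_right Q.integrable_const_bound [of _ 1]) auto
    have Iu: "(\<integral>v. ?u (G v) \<partial>Q) < ?I + e/2"
      using dint mult_left_mono [OF dint, of "2*B"] e1 \<open>0 \<le> B\<close> unfolding I
      by (simp add: Bochner_Integration.integral_add [OF gi di])
    have Il: "?I - e/2 < (\<integral>v. ?l (G v) \<partial>Q)"
      using dint mult_left_mono [OF dint, of "2*B"] e1 \<open>0 \<le> B\<close> unfolding I
      by (simp add: Bochner_Integration.integral_diff [OF gi di])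
    have "(\<lambda>n. outer_expectation P (\<lambda>\<omega>. ?u (X n \<omega>))) \<longlonglongrightarrow> (\<integral>v. ?u (G v) \<partial>Q)"
      using bu by (intro conv_bounded boundedI [of _ "3 * B"] continuous_map_add
          continuous_map_real_mult g(1) dcont) auto
    then have evu: "\<forall>\<^sub>F n in sequentially. outer_expectation P (\<lambda>\<omega>. ?u (X n \<omega>)) < ?I + e/2"
      using Iu by (rule order_tendstoD)
    have "(\<lambda>n. outer_expectation P (\<lambda>\<omega>. ?l (X n \<omega>))) \<longlonglongrightarrow> (\<integral>v. ?l (G v) \<partial>Q)"
      using bu by (intro conv_bounded boundedI [of _ "3 * B"] continuous_map_diff
          continuous_map_real_mult g(1) dcont) auto
    then have evl: "\<forall>\<^sub>F n in sequentially. ?I - e/2 < outer_expectation P (\<lambda>\<omega>. ?l (X n \<omega>))"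
      using Il by (rule order_tendstoD)
    show ?thesis
      using evu evl eventually_ge_at_top [of N]
    proof eventually_elim
      case (elim n)
      have hB: "- B \<le> h x" "h x \<le> B" for x using B [of x] by (auto simp: abs_le_iff)
      have uB: "- (3 * B) \<le> ?l (X n \<omega>)" "?u (X n \<omega>) \<le> 3 * B" if "\<omega> \<in> space P" for \<omega>
        using bu [OF Xm [OF that]] by (meson abs_le_D1 abs_le_D2 minus_le_iff)+
      have "?E n \<le> outer_expectation P (\<lambda>\<omega>. ?u (X n \<omega>)) + e/4"
      proof (rule outer_expectation_mono_add [OF P, of "-B" _ _ "3 * B"])
        fix \<omega> assume \<omega>: "\<omega> \<in> space P"
        show "h (W n \<omega>) \<le> ?u (X n \<omega>) + e/4"
          using close [OF elim(3) \<omega>] by (simp add: abs_le_iff)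
      qed (use hB uB in auto)
      moreover have "outer_expectation P (\<lambda>\<omega>. ?l (X n \<omega>)) \<le> ?E n + e/4"
      proof (rule outer_expectation_mono_add [OF P, of "-(3 * B)" _ _ B])
        fix \<omega> assume \<omega>: "\<omega> \<in> space P"
        show "?l (X n \<omega>) \<le> h (W n \<omega>) + e/4"
          using close [OF elim(3) \<omega>] by (simp add: abs_le_iff)
      qed (use hB uB in auto)
      ultimately show ?case using elim(1,2) by linarith
    qed
  qed
  show "?E \<longlonglongrightarrow> ?I"
    by (rule tendstoI) (use key in \<open>simp add: dist_real_def\<close>)
qed (use measurable_limit in auto)

end


section \<open>Mixtures and scaling in the space of bounded functions\<close>

lemma measurable_mixture [simp]: "measurable (mixture t \<mu> \<nu>) N = measurable \<mu> N"
  by (rule measurable_cong_sets) simp_all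

lemma nn_integral_mixture:
  assumes sets: "sets \<nu> = sets \<mu>" and f: "f \<in> borel_measurable \<mu>"
  shows "(\<integral>\<^sup>+x. f x \<partial>mixture t \<mu> \<nu>)
    = ennreal (1 - t) * (\<integral>\<^sup>+x. f x \<partial>\<mu>) + ennreal t * (\<integral>\<^sup>+x. f x \<partial>\<nu>)"
proof -
  have meas: "g \<in> borel_measurable \<nu>" if "g \<in> borel_measurable \<mu>" for g :: "'a \<Rightarrow> ennreal"
    using that measurable_cong_sets [OF sets refl, of borel] by blast
  show ?thesis
    using f
  proof (induction rule: borel_measurable_induct)
    case (cong f g)
    have "(\<integral>\<^sup>+x. f x \<partial>\<nu>) = (\<integral>\<^sup>+x. g x \<partial>\<nu>)"
      using cong(3) sets_eq_imp_space_eq [OF assms(1)] by (intro nn_integral_cong) auto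
    moreover have "(\<integral>\<^sup>+x. f x \<partial>\<mu>) = (\<integral>\<^sup>+x. g x \<partial>\<mu>)"
      "(\<integral>\<^sup>+x. f x \<partial>mixture t \<mu> \<nu>) = (\<integral>\<^sup>+x. g x \<partial>mixture t \<mu> \<nu>)"
      using cong(3) by (auto intro: nn_integral_cong)
    ultimately show ?case using cong by simp
  next
    case (set A)
    then show ?case using assms(1) by (simp add: emeasure_mixture)
  next
    case (mult u c)
    have [measurable]: "u \<in> borel_measurable \<mu>" "u \<in> borel_measurable \<nu>"
        "u \<in> borel_measurable (mixture t \<mu> \<nu>)"
      using mult(2) meas [OF mult(2)] by simp_all
    show ?case using mult by (simp add: nn_integral_cmult distrib_left mult.left_commute)
  next
    case (add u v)
    have [measurable]: "u \<in> borel_measurable \<nu>" "u \<in> borel_measurable (mixture t \<mu> \<nu>)"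
        "v \<in> borel_measurable \<nu>" "v \<in> borel_measurable (mixture t \<mu> \<nu>)"
      using add(1,3) meas [OF add(1)] meas [OF add(3)] by simp_all
    show ?case using add by (simp add: nn_integral_add distrib_left ac_simps)
  next
    case (seq U)
    have [measurable]: "U i \<in> borel_measurable \<nu>" "U i \<in> borel_measurable (mixture t \<mu> \<nu>)" for i
      using seq(1) meas [OF seq(1)] by simp_all
    have conv: "(\<lambda>i. \<integral>\<^sup>+x. U i x \<partial>M) \<longlonglongrightarrow> (\<integral>\<^sup>+x. Sup (range U) x \<partial>M)"
      if "\<And>i. U i \<in> borel_measurable M" for M
    proof (rule nn_integral_LIMSEQ [OF _ that])
      show "incseq U" by fact
      show "(\<lambda>i. U i x) \<longlonglongrightarrow> Sup (range U) x" for x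
        using LIMSEQ_SUP [of "\<lambda>i. U i x"] \<open>incseq U\<close>
        by (simp add: incseq_def le_fun_def image_comp)
    qed
    have "(\<lambda>i. ennreal (1 - t) * (\<integral>\<^sup>+x. U i x \<partial>\<mu>) + ennreal t * (\<integral>\<^sup>+x. U i x \<partial>\<nu>))
        \<longlonglongrightarrow> ennreal (1 - t) * (\<integral>\<^sup>+x. Sup (range U) x \<partial>\<mu>) + ennreal t * (\<integral>\<^sup>+x. Sup (range U) x \<partial>\<nu>)"
      using seq(1) by (intro tendsto_add ennreal_tendsto_cmult conv) auto
    moreover have "(\<lambda>i. \<integral>\<^sup>+x. U i x \<partial>mixture t \<mu> \<nu>) \<longlonglongrightarrow> (\<integral>\<^sup>+x. Sup (range U) x \<partial>mixture t \<mu> \<nu>)"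
      using seq(1) by (intro conv) simp
    ultimately show ?case using seq.IH LIMSEQ_unique by fastforce
  qed
qed

lemma integral_mixture:
  fixes f :: "'a \<Rightarrow> real"
  assumes sets: "sets \<nu> = sets \<mu>" and f: "integrable \<mu> f" "integrable \<nu> f" and t: "0 \<le> t" "t \<le> 1"
  shows "integrable (mixture t \<mu> \<nu>) f"
    and "(\<integral>x. f x \<partial>mixture t \<mu> \<nu>) = (1 - t) * (\<integral>x. f x \<partial>\<mu>) + t * (\<integral>x. f x \<partial>\<nu>)"
proof -
  let ?m = "mixture t \<mu> \<nu>"
  have [measurable]: "f \<in> borel_measurable \<mu>" using f by auto
  have meas: "f \<in> borel_measurable ?m"
    by simp
  have fin: "(\<integral>\<^sup>+x. ennreal (f x) \<partial>\<mu>) < \<infinity>" "(\<integral>\<^sup>+x. ennreal (- f x) \<partial>\<mu>) < \<infinity>"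
    "(\<integral>\<^sup>+x. ennreal (f x) \<partial>\<nu>) < \<infinity>" "(\<integral>\<^sup>+x. ennreal (- f x) \<partial>\<nu>) < \<infinity>"
    using f by (auto simp: real_integrable_def less_top)
  have eq: "(\<integral>\<^sup>+x. ennreal (f x) \<partial>?m)
      = ennreal (1 - t) * (\<integral>\<^sup>+x. ennreal (f x) \<partial>\<mu>) + ennreal t * (\<integral>\<^sup>+x. ennreal (f x) \<partial>\<nu>)"
    "(\<integral>\<^sup>+x. ennreal (- f x) \<partial>?m)
      = ennreal (1 - t) * (\<integral>\<^sup>+x. ennreal (- f x) \<partial>\<mu>) + ennreal t * (\<integral>\<^sup>+x. ennreal (- f x) \<partial>\<nu>)"
    by (intro nn_integral_mixture sets; measurable)+
  show int: "integrable ?m f"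
    unfolding real_integrable_def using meas fin
    by (auto simp: eq ennreal_mult_eq_top_iff)
  have e2r: "enn2real (ennreal (1 - t) * a + ennreal t * b) = (1 - t) * enn2real a + t * enn2real b"
    if "a < \<infinity>" "b < \<infinity>" for a b
    using that t by (subst enn2real_plus) (auto simp: ennreal_mult_less_top enn2real_mult)
  show "(\<integral>x. f x \<partial>?m) = (1 - t) * (\<integral>x. f x \<partial>\<mu>) + t * (\<integral>x. f x \<partial>\<nu>)"
    unfolding real_lebesgue_integral_def [OF int] real_lebesgue_integral_def [OF f(1)]
      real_lebesgue_integral_def [OF f(2)] eq e2r [OF fin(1,3)] e2r [OF fin(2,4)]
    by (simp add: algebra_simps)
qed

lemma linf_scale_in_linf:
  assumes "z \<in> mspace (linf \<F>)" shows "linf_scale \<F> t z \<in> mspace (linf \<F>)"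
proof -
  have "bounded ((\<lambda>x. t * x) ` z ` \<F>)"
    using assms bounded_scaling [of "z ` \<F>" t] by (simp add: mspace_linf)
  then show ?thesis by (simp add: mspace_linf linf_scale_def image_image)
qed

lemma linf_scale_scale: "linf_scale \<F> s (linf_scale \<F> t z) = linf_scale \<F> (s * t) z"
  by (auto simp: linf_scale_def)

lemma linf_scale_1: "z \<in> extensional \<F> \<Longrightarrow> linf_scale \<F> 1 z = z"
  by (auto simp: linf_scale_def extensional_def)

lemma linf_norm_cong: "(\<And>f. f \<in> \<F> \<Longrightarrow> z f = w f) \<Longrightarrow> linf_norm \<F> z = linf_norm \<F> w"
  unfolding linf_norm_def by (metis (no_types, lifting) image_cong)

lemma linf_norm_nonneg:
  assumes "z \<in> mspace (linf \<F>)" shows "0 \<le> linf_norm \<F> z"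
proof -
  have "bdd_above ((\<lambda>f. \<bar>z f\<bar>) ` \<F>)"
    using assms by (auto simp: mspace_linf bounded_iff bdd_above_def)
  then show ?thesis unfolding linf_norm_def by (intro cSup_upper) auto
qed

lemma linf_norm_scale:
  assumes z: "z \<in> mspace (linf \<F>)" and "0 \<le> t"
  shows "linf_norm \<F> (linf_scale \<F> t z) = t * linf_norm \<F> z"
proof (cases "\<F> = {} \<or> t = 0")
  case True
  then show ?thesis by (auto simp: linf_norm_def linf_scale_def image_constant_conv)
next
  case False
  then have "0 < t" "\<F> \<noteq> {}" using assms by auto
  have "linf_norm \<F> (linf_scale \<F> t z) = (SUP f\<in>\<F>. t * \<bar>z f\<bar>)"
    using linf_norm_eq_SUP [OF \<open>\<F> \<noteq> {}\<close> linf_scale_in_linf [OF z]] \<open>0 < t\<close>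
    by (simp add: linf_scale_def abs_mult)
  also have "\<dots> = t * (SUP f\<in>\<F>. \<bar>z f\<bar>)"
  proof -
    have "t * Sup ((\<lambda>f. \<bar>z f\<bar>) ` \<F>) = (SUP s\<in>(\<lambda>f. \<bar>z f\<bar>) ` \<F>. t * s)"
    proof (rule continuous_at_Sup_mono)
      show "mono (\<lambda>x. t * x)" using \<open>0 < t\<close> by (simp add: mono_def)
      show "bdd_above ((\<lambda>f. \<bar>z f\<bar>) ` \<F>)"
        using z by (auto simp: mspace_linf bounded_iff bdd_above_def)
    qed (use \<open>\<F> \<noteq> {}\<close> in \<open>auto intro!: continuous_intros\<close>)
    then show ?thesis by (simp add: image_image)
  qed
  finally show ?thesis using linf_norm_eq_SUP [OF \<open>\<F> \<noteq> {}\<close> z] by simp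
qed

lemma mdist_linf_scale:
  assumes "z \<in> mspace (linf \<F>)" "w \<in> mspace (linf \<F>)" "0 \<le> t"
  shows "mdist (linf \<F>) (linf_scale \<F> t z) (linf_scale \<F> t w) = t * mdist (linf \<F>) z w"
proof -
  have "(\<lambda>f\<in>\<F>. z f - w f) \<in> mspace (linf \<F>)"
    using assms by (auto simp: mspace_linf intro: bounded_minus_comp)
  from linf_norm_scale [OF this assms(3)]
  have "t * mdist (linf \<F>) z w = linf_norm \<F> (linf_scale \<F> t (\<lambda>f\<in>\<F>. z f - w f))"
    using assms by (simp add: mdist_linf)
  also have "\<dots> = linf_norm \<F> (\<lambda>f\<in>\<F>. linf_scale \<F> t z f - linf_scale \<F> t w f)"
    by (rule linf_norm_cong) (simp add: linf_scale_def right_diff_distrib)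
  finally show ?thesis
    using assms by (simp add: mdist_linf linf_scale_in_linf)
qed


section \<open>The derivative on the tangent cone\<close>

text \<open>The deterministic hypotheses on \<open>\<delta>\<close>, with the Lipschitz radius and constant fixed.\<close>

locale lipschitz_directional =
  fixes \<F> :: "('s::topological_space \<Rightarrow> real) set"
    and F :: "'s \<Rightarrow> real"
    and \<mu> :: "'s measure"
    and P0 :: "'s measure set"
    and \<delta> \<delta>' :: "'s measure \<Rightarrow> 'e::banach"
    and \<epsilon> C :: real
  assumes F_meas: "\<F> \<subseteq> borel_measurable borel"
    and envelope: "\<And>f x. f \<in> \<F> \<Longrightarrow> \<bar>f x\<bar> \<le> F x"
    and P0_sets: "\<And>\<nu>. \<nu> \<in> P0 \<Longrightarrow> sets \<nu> = sets borel"
    and convex: "convex_measures P0"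
    and \<mu>_in: "\<mu> \<in> P0"
    and F_int: "\<And>\<nu>. \<nu> \<in> P0 \<Longrightarrow> integrable \<nu> F"
    and \<epsilon>: "0 < \<epsilon>"
    and C: "0 \<le> C"
    and loc_Lipschitz: "\<And>\<nu> \<nu>'. \<nu> \<in> P0 \<Longrightarrow> \<nu>' \<in> P0 \<Longrightarrow>
      linf_norm \<F> (meas_diff \<F> \<nu> \<mu>) < \<epsilon> \<Longrightarrow> linf_norm \<F> (meas_diff \<F> \<nu>' \<mu>) < \<epsilon> \<Longrightarrow>
      norm (\<delta> \<nu> - \<delta> \<nu>') \<le> C * linf_norm \<F> (meas_diff \<F> \<nu> \<nu>')"
    and right_deriv: "\<And>\<nu>. \<nu> \<in> P0 \<Longrightarrow>
      ((\<lambda>t. (\<delta> (mixture t \<mu> \<nu>) - \<delta> \<mu>) /\<^sub>R t) \<longlongrightarrow> \<delta>' \<nu>) (at_right 0)"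
begin

abbreviation dir :: "real \<Rightarrow> 's measure \<Rightarrow> ('s \<Rightarrow> real) \<Rightarrow> real" where
  "dir s \<nu> \<equiv> linf_scale \<F> s (meas_diff \<F> \<nu> \<mu>)"

abbreviation dst :: "(('s \<Rightarrow> real) \<Rightarrow> real) \<Rightarrow> (('s \<Rightarrow> real) \<Rightarrow> real) \<Rightarrow> real" where
  "dst \<equiv> mdist (linf \<F>)"

definition cone :: "(('s \<Rightarrow> real) \<Rightarrow> real) set" where
  "cone = {dir t \<nu> | t \<nu>. t > 0 \<and> \<nu> \<in> P0}"

lemma dir_in_cone: "0 < t \<Longrightarrow> \<nu> \<in> P0 \<Longrightarrow> dir t \<nu> \<in> cone"
  unfolding cone_def by blast

abbreviation T :: "(('s \<Rightarrow> real) \<Rightarrow> real) set" where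
  "T \<equiv> tangent_cone \<F> P0 \<mu>"

lemma T_eq: "T = mtopology_of (linf \<F>) closure_of cone"
  by (simp add: tangent_cone_def cone_def)

interpretation Metric_space "mspace (linf \<F>)" dst by simp

lemma integrable_class:
  assumes "f \<in> \<F>" "\<nu> \<in> P0" shows "integrable \<nu> f"
proof (rule Bochner_Integration.integrable_bound [OF F_int [OF assms(2)]])
  show "f \<in> borel_measurable \<nu>"
    using F_meas assms measurable_cong_sets [OF P0_sets [OF assms(2)] refl] by blast
  show "AE x in \<nu>. norm (f x) \<le> norm (F x)"
    using envelope [OF assms(1)] by (intro AE_I2) (metis abs_ge_self order_trans real_norm_def)
qed

lemma meas_diff_in [simp]: "\<nu> \<in> P0 \<Longrightarrow> \<nu>' \<in> P0 \<Longrightarrow> meas_diff \<F> \<nu> \<nu>' \<in> mspace (linf \<F>)"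
  by (rule meas_diff_in_linf [where F = F]) (use F_meas envelope P0_sets F_int in auto)

lemma dir_in [simp]: "\<nu> \<in> P0 \<Longrightarrow> dir s \<nu> \<in> mspace (linf \<F>)"
  using linf_scale_in_linf meas_diff_in \<mu>_in by blast

lemma dir_1: "\<nu> \<in> P0 \<Longrightarrow> dir 1 \<nu> = meas_diff \<F> \<nu> \<mu>"
  by (simp add: linf_scale_1 meas_diff_def)

lemma dir_base: "dir s \<mu> = dir t \<mu>"
  by (auto simp: linf_scale_def meas_diff_def)

lemma dir_0: "dir 0 \<nu> = dir t \<mu>"
  by (auto simp: linf_scale_def meas_diff_def)

lemma mixture_in: "\<nu> \<in> P0 \<Longrightarrow> 0 \<le> t \<Longrightarrow> t \<le> 1 \<Longrightarrow> mixture t \<mu> \<nu> \<in> P0"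
  using convex \<mu>_in by (auto simp: convex_measures_def)

text \<open>Moving a fraction \<open>t\<close> of the way from \<open>\<mu>\<close> to \<open>\<nu>\<close> and magnifying by \<open>s\<close> gives the direction
  \<open>s t (\<nu> - \<mu>)\<close>. With the fraction \<open>t/s\<close>, the fixed direction \<open>t (\<nu> - \<mu>)\<close> is thus realised inside
  \<open>P0\<close> at every large scale \<open>s\<close>.\<close>

lemma dir_mixture:
  assumes "\<nu> \<in> P0" "0 \<le> t" "t \<le> 1"
  shows "dir s (mixture t \<mu> \<nu>) = dir (s * t) \<nu>"
proof
  fix f
  show "dir s (mixture t \<mu> \<nu>) f = dir (s * t) \<nu> f"
  proof (cases "f \<in> \<F>")
    case True
    have "sets \<nu> = sets \<mu>" using assms \<mu>_in P0_sets by simp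
    then have "(\<integral>x. f x \<partial>mixture t \<mu> \<nu>) = (1 - t) * (\<integral>x. f x \<partial>\<mu>) + t * (\<integral>x. f x \<partial>\<nu>)"
      using assms True \<mu>_in by (intro integral_mixture(2) integrable_class) auto
    then have "(\<integral>x. f x \<partial>mixture t \<mu> \<nu>) - (\<integral>x. f x \<partial>\<mu>) = t * ((\<integral>x. f x \<partial>\<nu>) - (\<integral>x. f x \<partial>\<mu>))"
      by (simp add: algebra_simps)
    then show ?thesis
      using True by (simp add: linf_scale_def meas_diff_def)
  qed (simp add: linf_scale_def)
qed

lemma dist_dir:
  assumes "\<nu> \<in> P0" "\<nu>' \<in> P0" "0 \<le> s"
  shows "dst (dir s \<nu>) (dir s \<nu>') = s * linf_norm \<F> (meas_diff \<F> \<nu> \<nu>')"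
proof -
  have "dst (dir s \<nu>) (dir s \<nu>') = s * dst (meas_diff \<F> \<nu> \<mu>) (meas_diff \<F> \<nu>' \<mu>)"
    using assms \<mu>_in by (intro mdist_linf_scale) auto
  also have "dst (meas_diff \<F> \<nu> \<mu>) (meas_diff \<F> \<nu>' \<mu>) = linf_norm \<F> (meas_diff \<F> \<nu> \<nu>')"
    using assms \<mu>_in by (simp add: mdist_linf) (rule linf_norm_cong, simp add: meas_diff_def)
  finally show ?thesis .
qed

text \<open>Seen at scale \<open>s\<close>, the \<open>\<epsilon>\<close>-ball about \<open>\<mu>\<close> has radius \<open>s \<epsilon>\<close>, while the Lipschitz constant is
  unchanged.\<close>

lemma increment_Lipschitz:
  assumes "\<nu> \<in> P0" "\<nu>' \<in> P0" "0 < s"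
    and "dst (dir s \<nu>) (dir 1 \<mu>) < s * \<epsilon>" "dst (dir s \<nu>') (dir 1 \<mu>) < s * \<epsilon>"
  shows "norm (s *\<^sub>R (\<delta> \<nu> - \<delta> \<nu>')) \<le> C * dst (dir s \<nu>) (dir s \<nu>')"
proof -
  have "linf_norm \<F> (meas_diff \<F> \<nu> \<mu>) < \<epsilon>" "linf_norm \<F> (meas_diff \<F> \<nu>' \<mu>) < \<epsilon>"
    using assms dist_dir [of \<nu> \<mu> s] dist_dir [of \<nu>' \<mu> s] \<mu>_in by (simp_all add: dir_base [of 1 s])
  then have "norm (\<delta> \<nu> - \<delta> \<nu>') \<le> C * linf_norm \<F> (meas_diff \<F> \<nu> \<nu>')"
    using loc_Lipschitz assms by blast
  then show ?thesis
    using assms by (simp add: dist_dir mult.left_commute)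
qed

text \<open>The right derivative, with step \<open>t/s\<close> for \<open>s \<rightarrow> \<infinity>\<close> in place of a step tending to \<open>0\<close>.\<close>

lemma increment_tendsto:
  assumes "\<nu> \<in> P0" "0 < t"
  shows "((\<lambda>s. s *\<^sub>R (\<delta> (mixture (t / s) \<mu> \<nu>) - \<delta> \<mu>)) \<longlongrightarrow> t *\<^sub>R \<delta>' \<nu>) at_top"
proof -
  have "filterlim (\<lambda>s. t / s) (at_right 0) at_top"
    unfolding filterlim_at
    using assms by (auto intro!: tendsto_divide_0 [OF tendsto_const] filterlim_at_top_imp_at_infinity
        filterlim_ident eventually_mono [OF eventually_gt_at_top [of 0]])
  from filterlim_compose [OF right_deriv [OF assms(1)] this]
  have "((\<lambda>s. t *\<^sub>R ((\<delta> (mixture (t / s) \<mu> \<nu>) - \<delta> \<mu>) /\<^sub>R (t / s))) \<longlongrightarrow> t *\<^sub>R \<delta>' \<nu>) at_top"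
    by (rule tendsto_scaleR [OF tendsto_const])
  then show ?thesis
    using assms by simp
qed

lemma eventually_dst_less: "\<forall>\<^sub>F s in at_top. dst z w + c < s * \<epsilon>"
  using eventually_gt_at_top [of "(dst z w + c) / \<epsilon>"]
  by eventually_elim (use \<epsilon> in \<open>simp add: field_simps\<close>)

text \<open>At each large scale \<open>s\<close> the two directions are realised by mixtures, whose increments differ by
  at most \<open>C\<close> times the distance of the directions; the bound passes to the limit. For equal
  directions it shows that the derivative does not depend on the choice of \<open>t\<close> and \<open>\<nu>\<close>.\<close>

lemma cone_Lipschitz:
  assumes "\<nu> \<in> P0" "0 < t" "\<nu>' \<in> P0" "0 < t'"
  shows "norm (t *\<^sub>R \<delta>' \<nu> - t' *\<^sub>R \<delta>' \<nu>') \<le> C * dst (dir t \<nu>) (dir t' \<nu>')"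
proof (rule tendsto_upperbound)
  show "((\<lambda>s. norm (s *\<^sub>R (\<delta> (mixture (t / s) \<mu> \<nu>) - \<delta> \<mu>)
      - s *\<^sub>R (\<delta> (mixture (t' / s) \<mu> \<nu>') - \<delta> \<mu>))) \<longlongrightarrow> norm (t *\<^sub>R \<delta>' \<nu> - t' *\<^sub>R \<delta>' \<nu>')) at_top"
    using assms by (intro tendsto_norm tendsto_diff increment_tendsto)
  show "\<forall>\<^sub>F s in at_top. norm (s *\<^sub>R (\<delta> (mixture (t / s) \<mu> \<nu>) - \<delta> \<mu>)
      - s *\<^sub>R (\<delta> (mixture (t' / s) \<mu> \<nu>') - \<delta> \<mu>)) \<le> C * dst (dir t \<nu>) (dir t' \<nu>')"
    using eventually_gt_at_top [of t] eventually_gt_at_top [of t']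
      eventually_dst_less [of "dir t \<nu>" "dir 1 \<mu>" 0] eventually_dst_less [of "dir t' \<nu>'" "dir 1 \<mu>" 0]
  proof eventually_elim
    case (elim s)
    then have s: "0 < s" "t / s \<le> 1" "t' / s \<le> 1" "0 \<le> t / s" "0 \<le> t' / s" using assms by auto
    have "norm (s *\<^sub>R (\<delta> (mixture (t / s) \<mu> \<nu>) - \<delta> (mixture (t' / s) \<mu> \<nu>')))
      \<le> C * dst (dir s (mixture (t / s) \<mu> \<nu>)) (dir s (mixture (t' / s) \<mu> \<nu>'))"
      using s elim assms by (intro increment_Lipschitz mixture_in) (auto simp: dir_mixture)
    then show ?case
      using s assms by (simp add: dir_mixture flip: scaleR_diff_right)
  qed
qed simp

lemma cone_subset: "cone \<subseteq> mspace (linf \<F>)"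
  by (auto simp: cone_def)

lemma cone_subset_T: "cone \<subseteq> T"
  unfolding T_eq by (rule closure_of_subset) (simp add: cone_subset)

lemma closedin_T: "closedin (mtopology_of (linf \<F>)) T"
  unfolding T_eq by simp

lemma T_subset: "T \<subseteq> mspace (linf \<F>)"
  using closedin_subset [OF closedin_T] by simp

lemma dir_in_T: "\<nu> \<in> P0 \<Longrightarrow> 0 \<le> s \<Longrightarrow> dir s \<nu> \<in> T"
proof -
  assume *: "\<nu> \<in> P0" "0 \<le> s"
  have "dir s \<nu> \<in> cone"
  proof (cases "s = 0")
    \<comment> \<open>The zero direction also arises from \<open>\<nu> = \<mu>\<close> with the admissible factor \<open>1\<close>.\<close>
    case True
    then have "dir s \<nu> = dir 1 \<mu>" by (simp add: dir_0)
    then show ?thesis using \<mu>_in by (simp add: dir_in_cone)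
  qed (use * in \<open>simp add: dir_in_cone\<close>)
  then show ?thesis using cone_subset_T by blast
qed

lemma eq_on_T:
  fixes D1 D2 :: "_ \<Rightarrow> 'e"
  assumes "continuous_map (subtopology (mtopology_of (linf \<F>)) T) euclidean D1"
    and "continuous_map (subtopology (mtopology_of (linf \<F>)) T) euclidean D2"
    and "\<And>z. z \<in> cone \<Longrightarrow> D1 z = D2 z" "z \<in> T"
  shows "D1 z = D2 z"
proof (rule forall_in_closure_of_eq [OF _ _ assms(1,2)])
  show "z \<in> (subtopology (mtopology_of (linf \<F>)) T) closure_of cone"
    using assms(4) cone_subset_T by (simp add: closure_of_subtopology T_eq [symmetric] Int_absorb1)
qed (use assms(3) in auto)

lemma linf_scale_in_T:
  assumes "z \<in> T" "0 < t" shows "linf_scale \<F> t z \<in> T"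
    and "continuous_map (subtopology (mtopology_of (linf \<F>)) T)
      (subtopology (mtopology_of (linf \<F>)) T) (linf_scale \<F> t)"
proof -
  have "Lipschitz_continuous_map (linf \<F>) (linf \<F>) (linf_scale \<F> t)"
    unfolding Lipschitz_continuous_map_def using \<open>0 < t\<close> linf_scale_in_linf
    by (auto intro!: exI [of _ t] simp: mdist_linf_scale)
  then have cont: "continuous_map (mtopology_of (linf \<F>)) (mtopology_of (linf \<F>)) (linf_scale \<F> t)"
    by (rule Lipschitz_continuous_imp_continuous_map)
  have "linf_scale \<F> t ` cone \<subseteq> cone"
    using \<open>0 < t\<close> unfolding cone_def by (fastforce simp: linf_scale_scale)
  then have sub: "linf_scale \<F> t ` T \<subseteq> T"
    unfolding T_eq using continuous_map_image_closure_subset [OF cont, of cone] closure_of_mono by blast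
  then show "linf_scale \<F> t z \<in> T" using assms by blast
  show "continuous_map (subtopology (mtopology_of (linf \<F>)) T)
      (subtopology (mtopology_of (linf \<F>)) T) (linf_scale \<F> t)"
    using cont sub by (auto simp: continuous_map_in_subtopology intro: continuous_map_from_subtopology)
qed

lemma tangent_extension_unique:
  assumes "tangent_extension \<F> P0 \<mu> \<delta>' D1" "tangent_extension \<F> P0 \<mu> \<delta>' D2" "z \<in> T"
  shows "D1 z = D2 z"
proof (rule eq_on_T [OF _ _ _ assms(3)])
  have cone_eq: "D (dir t \<nu>) = t *\<^sub>R \<delta>' \<nu>"
    if "tangent_extension \<F> P0 \<mu> \<delta>' D" "0 < t" "\<nu> \<in> P0" for D t \<nu>
    using that dir_in_T [of \<nu> 1] by (simp add: tangent_extension_def dir_1)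
  show "D1 z = D2 z" if "z \<in> cone" for z
    using that cone_eq [OF assms(1)] cone_eq [OF assms(2)] by (auto simp: cone_def)
qed (use assms in \<open>auto simp: tangent_extension_def\<close>)

text \<open>The Lipschitz bound is kept as a conclusion because the approximation of increments below
  uses it.\<close>

lemma tangent_extension_exists:
  obtains D B where "tangent_extension \<F> P0 \<mu> \<delta>' D" "0 < B"
    "\<And>z w. z \<in> T \<Longrightarrow> w \<in> T \<Longrightarrow> norm (D z - D w) \<le> B * dst z w"
    "\<And>t \<nu>. 0 < t \<Longrightarrow> \<nu> \<in> P0 \<Longrightarrow> D (dir t \<nu>) = t *\<^sub>R \<delta>' \<nu>"
proof -
  define D0 where "D0 z = (SOME e. \<exists>t \<nu>. 0 < t \<and> \<nu> \<in> P0 \<and> z = dir t \<nu> \<and> e = t *\<^sub>R \<delta>' \<nu>)" for z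
  have D0: "D0 (dir t \<nu>) = t *\<^sub>R \<delta>' \<nu>" if "0 < t" "\<nu> \<in> P0" for t \<nu>
    unfolding D0_def
  proof (rule some_equality)
    show "\<exists>t' \<nu>'. 0 < t' \<and> \<nu>' \<in> P0 \<and> dir t \<nu> = dir t' \<nu>' \<and> t *\<^sub>R \<delta>' \<nu> = t' *\<^sub>R \<delta>' \<nu>'"
      using that by blast
    fix e assume "\<exists>t' \<nu>'. 0 < t' \<and> \<nu>' \<in> P0 \<and> dir t \<nu> = dir t' \<nu>' \<and> e = t' *\<^sub>R \<delta>' \<nu>'"
    then obtain t' \<nu>' where e: "0 < t'" "\<nu>' \<in> P0" "dir t \<nu> = dir t' \<nu>'" "e = t' *\<^sub>R \<delta>' \<nu>'" by blast
    then show "e = t *\<^sub>R \<delta>' \<nu>"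
      using cone_Lipschitz [OF e(2,1) that(2,1)] that by simp
  qed
  have "Lipschitz_continuous_map (submetric (linf \<F>) cone) euclidean_metric D0"
    unfolding Lipschitz_continuous_map_def
    by (auto intro!: exI [of _ C] simp: cone_def D0 dist_norm cone_Lipschitz)
  moreover have "mcomplete_of (euclidean_metric :: 'e metric)"
    using complete_UNIV by (simp add: euclidean_metric_def Met_TC.mcomplete_of)
  ultimately obtain D where
    Lip: "Lipschitz_continuous_map (submetric (linf \<F>) T) euclidean_metric D"
    and "\<And>z. z \<in> cone \<Longrightarrow> D z = D0 z"
    unfolding T_eq using Lipschitz_continuous_map_extends_to_closure_of by blast
  then have D: "D (dir t \<nu>) = t *\<^sub>R \<delta>' \<nu>" if "0 < t" "\<nu> \<in> P0" for t \<nu>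
    using that D0 dir_in_cone by metis
  obtain B where B: "0 < B" "\<And>z w. z \<in> T \<Longrightarrow> w \<in> T \<Longrightarrow> norm (D z - D w) \<le> B * dst z w"
    using Lip T_subset unfolding Lipschitz_continuous_map_pos by (auto simp: dist_norm subset_iff)
  have cont: "continuous_map (subtopology (mtopology_of (linf \<F>)) T) euclidean D"
    using Lipschitz_continuous_imp_continuous_map [OF Lip] by (simp add: mtopology_of_submetric)
  have hom: "D (linf_scale \<F> t z) = t *\<^sub>R D z" if "z \<in> T" "0 < t" for z t
  proof (rule eq_on_T [OF _ _ _ that(1)])
    show "continuous_map (subtopology (mtopology_of (linf \<F>)) T) euclidean (\<lambda>z. D (linf_scale \<F> t z))"
      using continuous_map_compose [OF linf_scale_in_T(2) [OF that] cont] by (simp add: o_def)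
    show "continuous_map (subtopology (mtopology_of (linf \<F>)) T) euclidean (\<lambda>z. t *\<^sub>R D z)"
      using continuous_map_compose [OF cont, of euclidean "\<lambda>x. t *\<^sub>R x"]
      by (simp add: o_def continuous_on_scaleR)
    show "D (linf_scale \<F> t z) = t *\<^sub>R D z" if "z \<in> cone" for z
      using that \<open>0 < t\<close> D by (auto simp: cone_def linf_scale_scale)
  qed
  have "tangent_extension \<F> P0 \<mu> \<delta>' D"
    unfolding tangent_extension_def using D [of 1] cont hom by (simp add: dir_1)
  then show thesis using that B D by blast
qed

text \<open>Finitely many cone directions \<open>w\<close> come within \<open>2 r\<close> of every point of \<open>K\<close>. At each of them
  the increments converge to \<open>D w\<close>, hence simultaneously for large \<open>s\<close>. Any direction within \<open>r\<close>
  of \<open>K\<close> is within \<open>3 r\<close> of such a \<open>w\<close>, and the Lipschitz bounds of the increments and of \<open>D\<close>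
  transfer the estimate from \<open>w\<close> to it.\<close>

lemma increment_approx_near_compact:
  assumes D: "0 < B" "\<And>z w. z \<in> T \<Longrightarrow> w \<in> T \<Longrightarrow> norm (D z - D w) \<le> B * dst z w"
    "\<And>t \<nu>. 0 < t \<Longrightarrow> \<nu> \<in> P0 \<Longrightarrow> D (dir t \<nu>) = t *\<^sub>R \<delta>' \<nu>"
    and K: "compactin (mtopology_of (linf \<F>)) K" "K \<subseteq> T" and "0 < \<eta>"
  obtains r where "0 < r" "\<forall>\<^sub>F s in at_top. \<forall>\<nu>\<in>P0. (\<exists>k\<in>K. dst (dir s \<nu>) k < r)
    \<longrightarrow> norm (s *\<^sub>R (\<delta> \<nu> - \<delta> \<mu>) - D (dir s \<nu>)) \<le> \<eta>"
proof -
  \<comment> \<open>Passing from a direction to \<open>w\<close> costs \<open>3 r (B + C)\<close> in total, which may use up \<open>\<eta>/2\<close>.\<close>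
  define r where "r = \<eta> / (6 * (B + C))"
  have r: "0 < r" "3 * r * (B + C) = \<eta> / 2"
    using D(1) C \<open>0 < \<eta>\<close> by (auto simp: r_def field_simps)
  have "mtotally_bounded K"
    using K compactin_imp_mtotally_bounded by (simp add: mtopology_of_def)
  then obtain K0 where K0: "finite K0" "K0 \<subseteq> K" "K \<subseteq> (\<Union>x\<in>K0. mball x r)"
    unfolding mtotally_bounded_def using r(1) by meson
  have "\<exists>t \<nu>. 0 < t \<and> \<nu> \<in> P0 \<and> dst k (dir t \<nu>) < r" if "k \<in> K0" for k
  proof -
    have "k \<in> mtopology closure_of cone"
      using that K0 K(2) T_eq by (auto simp: mtopology_of_def)
    then have "\<exists>w\<in>cone. w \<in> mball k r" using r(1) unfolding metric_closure_of by blast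
    then show ?thesis by (auto simp: cone_def)
  qed
  then obtain t \<nu>0 where w: "\<And>k. k \<in> K0 \<Longrightarrow> 0 < t k" "\<And>k. k \<in> K0 \<Longrightarrow> \<nu>0 k \<in> P0"
    "\<And>k. k \<in> K0 \<Longrightarrow> dst k (dir (t k) (\<nu>0 k)) < r"
    by metis
  have "\<forall>\<^sub>F s in at_top. \<forall>k\<in>K0. t k < s \<and> dst (dir (t k) (\<nu>0 k)) (dir 1 \<mu>) + 3 * r < s * \<epsilon> \<and>
      dist (s *\<^sub>R (\<delta> (mixture (t k / s) \<mu> (\<nu>0 k)) - \<delta> \<mu>)) (t k *\<^sub>R \<delta>' (\<nu>0 k)) < \<eta> / 2"
    using w \<open>0 < \<eta>\<close>
    by (intro eventually_ball_finite [OF K0(1)] ballI eventually_conj eventually_gt_at_top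
        eventually_dst_less tendstoD increment_tendsto) auto
  then have "\<forall>\<^sub>F s in at_top. \<forall>\<nu>\<in>P0. (\<exists>k\<in>K. dst (dir s \<nu>) k < r)
    \<longrightarrow> norm (s *\<^sub>R (\<delta> \<nu> - \<delta> \<mu>) - D (dir s \<nu>)) \<le> \<eta>"
  proof (eventually_elim, intro ballI impI)
    fix s \<nu>
    assume s: "\<forall>k\<in>K0. t k < s \<and> dst (dir (t k) (\<nu>0 k)) (dir 1 \<mu>) + 3 * r < s * \<epsilon> \<and>
        dist (s *\<^sub>R (\<delta> (mixture (t k / s) \<mu> (\<nu>0 k)) - \<delta> \<mu>)) (t k *\<^sub>R \<delta>' (\<nu>0 k)) < \<eta> / 2"
      and \<nu>: "\<nu> \<in> P0" and "\<exists>k\<in>K. dst (dir s \<nu>) k < r"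
    then obtain k where k: "k \<in> K" "dst (dir s \<nu>) k < r" by blast
    then obtain k0 where k0: "k0 \<in> K0" "k \<in> mball k0 r" using K0 by blast
    define w0 where "w0 = dir (t k0) (\<nu>0 k0)"
    define \<nu>s where "\<nu>s = mixture (t k0 / s) \<mu> (\<nu>0 k0)"
    note ws = w [OF k0(1)]
    have s0: "t k0 < s" "0 < s" "t k0 / s \<le> 1" "0 \<le> t k0 / s" using s k0 ws by force+
    have "\<nu>s \<in> P0" unfolding \<nu>s_def using ws s0 by (intro mixture_in) auto
    have w0: "dir s \<nu>s = w0" unfolding \<nu>s_def w0_def using ws s0 by (subst dir_mixture) auto
    have mem: "w0 \<in> mspace (linf \<F>)" "dir s \<nu> \<in> mspace (linf \<F>)" "k \<in> mspace (linf \<F>)"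
      "k0 \<in> mspace (linf \<F>)" "dir 1 \<mu> \<in> mspace (linf \<F>)"
      unfolding w0_def using ws \<nu> k0 \<mu>_in by auto
    have close: "dst (dir s \<nu>) w0 < 3 * r"
      using triangle [of "dir s \<nu>" k w0] triangle [of k k0 w0] mem k k0 ws(3)
      by (simp add: commute w0_def)
    have small: "dst w0 (dir 1 \<mu>) + 3 * r < s * \<epsilon>" using s k0 by (simp add: w0_def)
    have "norm (s *\<^sub>R (\<delta> \<nu> - \<delta> \<nu>s)) \<le> C * dst (dir s \<nu>) (dir s \<nu>s)"
    proof (rule increment_Lipschitz [OF \<nu> \<open>\<nu>s \<in> P0\<close> \<open>0 < s\<close>])
      show "dst (dir s \<nu>) (dir 1 \<mu>) < s * \<epsilon>"
        using triangle [of "dir s \<nu>" w0 "dir 1 \<mu>"] mem close small by linarith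
      show "dst (dir s \<nu>s) (dir 1 \<mu>) < s * \<epsilon>" using small r(1) by (simp add: w0)
    qed
    also have "\<dots> \<le> C * (3 * r)" using close C by (intro mult_left_mono) (auto simp: w0)
    finally have 1: "norm (s *\<^sub>R (\<delta> \<nu> - \<delta> \<nu>s)) \<le> C * (3 * r)" .
    have 2: "norm (s *\<^sub>R (\<delta> \<nu>s - \<delta> \<mu>) - D w0) \<le> \<eta> / 2"
      using s k0 D(3) ws unfolding \<nu>s_def w0_def by (simp add: dist_norm less_imp_le)
    have "norm (D w0 - D (dir s \<nu>)) \<le> B * dst w0 (dir s \<nu>)"
      unfolding w0_def using ws \<nu> s0(2) by (intro D(2) dir_in_T) auto
    also have "\<dots> \<le> B * (3 * r)" using close D(1) by (intro mult_left_mono) (auto simp: commute)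
    finally have 3: "norm (D w0 - D (dir s \<nu>)) \<le> B * (3 * r)" .
    have "s *\<^sub>R (\<delta> \<nu> - \<delta> \<mu>) - D (dir s \<nu>)
      = s *\<^sub>R (\<delta> \<nu> - \<delta> \<nu>s) + (s *\<^sub>R (\<delta> \<nu>s - \<delta> \<mu>) - D w0) + (D w0 - D (dir s \<nu>))"
      by (simp add: algebra_simps)
    then have "norm (s *\<^sub>R (\<delta> \<nu> - \<delta> \<mu>) - D (dir s \<nu>)) \<le> C * (3 * r) + \<eta> / 2 + B * (3 * r)"
      using norm_triangle_mono [OF norm_triangle_mono [OF 1 2] 3] by simp
    also have "\<dots> = \<eta>" using r(2) by (simp add: algebra_simps)
    finally show "norm (s *\<^sub>R (\<delta> \<nu> - \<delta> \<mu>) - D (dir s \<nu>)) \<le> \<eta>" .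
  qed
  then show thesis using that r(1) by blast
qed

end


section \<open>The delta method\<close>

theorem proposition1:
  fixes \<F> :: "('s::topological_space \<Rightarrow> real) set"
    and F :: "'s \<Rightarrow> real"
    and \<mu> :: "'s measure"
    and P0 :: "'s measure set"
    and \<delta> \<delta>' :: "'s measure \<Rightarrow> 'e::banach"
    and P :: "'w measure"
    and \<mu>n :: "nat \<Rightarrow> 'w \<Rightarrow> 's measure"
    and Q :: "'v measure"
    and G :: "'v \<Rightarrow> ('s \<Rightarrow> real) \<Rightarrow> real"
  assumes F_meas: "\<F> \<subseteq> borel_measurable borel"
    and envelope: "F \<in> borel_measurable borel" "\<And>x. 0 \<le> F x"
      "\<And>f x. f \<in> \<F> \<Longrightarrow> \<bar>f x\<bar> \<le> F x"
    and P0: "P0 \<subseteq> {\<nu>. prob_space \<nu> \<and> sets \<nu> = sets borel}" "convex_measures P0" "\<mu> \<in> P0"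
      "\<And>\<nu>. \<nu> \<in> P0 \<Longrightarrow> integrable \<nu> F"
    and prob: "prob_space P" "prob_space Q"
    and mun: "\<And>n. \<mu>n n \<in> measurable P (prob_algebra borel)"
      "\<And>n \<omega>. \<omega> \<in> space P \<Longrightarrow> \<mu>n n \<omega> \<in> P0"
    and G_tight: "tight_rv Q (mtopology_of (linf \<F>)) G"
    and mun_conv: "HJ_conv_in_dist P (mtopology_of (linf \<F>))
      (\<lambda>n \<omega>. linf_scale \<F> (sqrt (real n)) (meas_diff \<F> (\<mu>n n \<omega>) \<mu>)) Q G"
    and loc_Lipschitz: "\<exists>\<epsilon>>0. \<exists>C. \<forall>\<nu>\<in>P0. \<forall>\<nu>'\<in>P0.
      max (linf_norm \<F> (meas_diff \<F> \<nu> \<mu>)) (linf_norm \<F> (meas_diff \<F> \<nu>' \<mu>)) < \<epsilon> \<longrightarrow>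
      norm (\<delta> \<nu> - \<delta> \<nu>') \<le> C * linf_norm \<F> (meas_diff \<F> \<nu> \<nu>')"
    and right_deriv: "\<And>\<nu>. \<nu> \<in> P0 \<Longrightarrow>
      ((\<lambda>t. (\<delta> (mixture t \<mu> \<nu>) - \<delta> \<mu>) /\<^sub>R t) \<longlongrightarrow> \<delta>' \<nu>) (at_right 0)"
  shows "(AE \<omega> in Q. G \<omega> \<in> tangent_cone \<F> P0 \<mu>) \<and>
    (\<exists>D. tangent_extension \<F> P0 \<mu> \<delta>' D \<and>
      (\<forall>D'. tangent_extension \<F> P0 \<mu> \<delta>' D' \<longrightarrow> (\<forall>z\<in>tangent_cone \<F> P0 \<mu>. D' z = D z)) \<and>
      conv_outer_prob_0 P (\<lambda>n \<omega>. sqrt (real n) *\<^sub>R (\<delta> (\<mu>n n \<omega>) - \<delta> \<mu>)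
        - D (linf_scale \<F> (sqrt (real n)) (meas_diff \<F> (\<mu>n n \<omega>) \<mu>))) \<and>
      HJ_conv_in_dist P euclidean (\<lambda>n \<omega>. sqrt (real n) *\<^sub>R (\<delta> (\<mu>n n \<omega>) - \<delta> \<mu>))
        Q (\<lambda>\<omega>. if G \<omega> \<in> tangent_cone \<F> P0 \<mu> then D (G \<omega>) else 0))"
proof -
  obtain \<epsilon> C0 where \<epsilon>: "0 < \<epsilon>" and Lip0: "\<And>\<nu> \<nu>'. \<nu> \<in> P0 \<Longrightarrow> \<nu>' \<in> P0 \<Longrightarrow>
      max (linf_norm \<F> (meas_diff \<F> \<nu> \<mu>)) (linf_norm \<F> (meas_diff \<F> \<nu>' \<mu>)) < \<epsilon> \<Longrightarrow>
      norm (\<delta> \<nu> - \<delta> \<nu>') \<le> C0 * linf_norm \<F> (meas_diff \<F> \<nu> \<nu>')"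
    using loc_Lipschitz by metis
  have sets: "sets \<nu> = sets borel" if "\<nu> \<in> P0" for \<nu>
    using P0(1) that by blast
  \<comment> \<open>The given constant may be negative; enlarging it to \<open>max C0 0\<close> keeps the bound.\<close>
  interpret lipschitz_directional \<F> F \<mu> P0 \<delta> \<delta>' \<epsilon> "max C0 0"
  proof (unfold_locales)
    fix \<nu> \<nu>' assume *: "\<nu> \<in> P0" "\<nu>' \<in> P0"
      "linf_norm \<F> (meas_diff \<F> \<nu> \<mu>) < \<epsilon>" "linf_norm \<F> (meas_diff \<F> \<nu>' \<mu>) < \<epsilon>"
    have "meas_diff \<F> \<nu> \<nu>' \<in> mspace (linf \<F>)"
      using F_meas envelope(3) sets P0(4) * by (intro meas_diff_in_linf [where F = F]) auto
    then have "C0 * linf_norm \<F> (meas_diff \<F> \<nu> \<nu>') \<le> max C0 0 * linf_norm \<F> (meas_diff \<F> \<nu> \<nu>')"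
      by (intro mult_right_mono linf_norm_nonneg) auto
    then show "norm (\<delta> \<nu> - \<delta> \<nu>') \<le> max C0 0 * linf_norm \<F> (meas_diff \<F> \<nu> \<nu>')"
      using Lip0 [of \<nu> \<nu>'] * by simp
  qed (use F_meas envelope(3) sets P0(2-4) \<epsilon> right_deriv in auto)
  obtain D B where D: "tangent_extension \<F> P0 \<mu> \<delta>' D" "0 < B"
    "\<And>z w. z \<in> T \<Longrightarrow> w \<in> T \<Longrightarrow> norm (D z - D w) \<le> B * dst z w"
    "\<And>t \<nu>. 0 < t \<Longrightarrow> \<nu> \<in> P0 \<Longrightarrow> D (dir t \<nu>) = t *\<^sub>R \<delta>' \<nu>"
    using tangent_extension_exists by metis
  interpret L: HJ_limit_approx "linf \<F>" T P "\<lambda>n \<omega>. dir (sqrt (real n)) (\<mu>n n \<omega>)" Q G D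
    "\<lambda>n \<omega>. sqrt (real n) *\<^sub>R (\<delta> (\<mu>n n \<omega>) - \<delta> \<mu>)"
  proof (intro HJ_limit_approx.intro HJ_limit_in_closed.intro HJ_limit_approx_axioms.intro)
    show "prob_space P" "prob_space Q" by (rule prob)+
    show "closedin (mtopology_of (linf \<F>)) T" by (rule closedin_T)
    show "dir (sqrt (real n)) (\<mu>n n \<omega>) \<in> T" if "\<omega> \<in> space P" for n \<omega>
      using mun(2) [OF that] by (rule dir_in_T) simp
    show "HJ_conv_in_dist P (mtopology_of (linf \<F>)) (\<lambda>n \<omega>. dir (sqrt (real n)) (\<mu>n n \<omega>)) Q G"
      by (rule mun_conv)
    show "tight_rv Q (mtopology_of (linf \<F>)) G" by (rule G_tight)
    show "continuous_map (subtopology (mtopology_of (linf \<F>)) T) euclidean D"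
      using D(1) by (simp add: tangent_extension_def)
    fix K and \<eta> :: real
    assume K: "compactin (mtopology_of (linf \<F>)) K" "K \<subseteq> T" and "0 < \<eta>"
    obtain r where r: "0 < r" "\<forall>\<^sub>F s in at_top. \<forall>\<nu>\<in>P0. (\<exists>k\<in>K. dst (dir s \<nu>) k < r)
        \<longrightarrow> norm (s *\<^sub>R (\<delta> \<nu> - \<delta> \<mu>) - D (dir s \<nu>)) \<le> \<eta>"
      by (rule increment_approx_near_compact [OF D(2-4) K \<open>0 < \<eta>\<close>])
    have "filterlim (\<lambda>n. sqrt (real n)) at_top sequentially"
      by (rule filterlim_compose [OF sqrt_at_top filterlim_real_sequentially])
    from eventually_compose_filterlim [OF r(2) this]
    obtain N where "\<forall>n\<ge>N. \<forall>\<nu>\<in>P0. (\<exists>k\<in>K. dst (dir (sqrt (real n)) \<nu>) k < r)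
        \<longrightarrow> norm (sqrt (real n) *\<^sub>R (\<delta> \<nu> - \<delta> \<mu>) - D (dir (sqrt (real n)) \<nu>)) \<le> \<eta>"
      unfolding eventually_sequentially by blast
    with r(1) mun(2) show "\<exists>N r. 0 < r \<and> (\<forall>n\<ge>N. \<forall>\<omega>\<in>space P.
        (\<exists>k\<in>K. dst (dir (sqrt (real n)) (\<mu>n n \<omega>)) k < r) \<longrightarrow>
        norm (sqrt (real n) *\<^sub>R (\<delta> (\<mu>n n \<omega>) - \<delta> \<mu>) - D (dir (sqrt (real n)) (\<mu>n n \<omega>))) \<le> \<eta>)"
      by (intro exI [of _ N] exI [of _ r]) simp
  qed
  show ?thesis
  proof (intro conjI exI [of _ D] allI impI ballI)
    show "D' z = D z" if "tangent_extension \<F> P0 \<mu> \<delta>' D'" "z \<in> T" for D' z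
      by (rule tangent_extension_unique [OF that(1) D(1) that(2)])
  qed (fact L.limit_in_closed D(1) L.conv_outer_prob_0_diff L.HJ_conv_in_dist_approx)+
qed

end
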